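(* Let $(X,\rho,\mu)$ be a space of homogeneous type satisfying the standing assumptions listed in the context, and suppose in addition that for every $x\in X$ the function $t\mapsto\mu B(x,t)$ is continuous. Let $1<p<\infty$, $0\le\lambda<1$, $0<\alpha<\frac{1-\lambda}{p}$ and $\frac1p-\frac1q=\frac{\alpha}{1-\lambda}$. Let $\theta_1>0$ and set $$\theta_2=\theta_1\left(1+\frac{\alpha q}{1-\lambda}\right).$$ Then the potential operator $$(T_\alpha f)(x)=\int_X\frac{f(y)}{\mu B(x,\rho(x,y))^{1-\alpha}}\,d\mu(y),\qquad x\in X,$$ is bounded from $L^{p),\theta_1,\lambda}(X,\mu)$ to $L^{q),\theta_2,\lambda}(X,\mu)$; that is, there is a constant $C>0$ such that $\|T_\alpha f\|_{L^{q),\theta_2,\lambda}(X,\mu)}\le C\|f\|_{L^{p),\theta_1,\lambda}(X,\mu)}$ for all $f\in L^{p),\theta_1,\lambda}(X,\mu)$.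
   Context: Standing assumptions on $(X,\rho,\mu)$. $X$ is a topological space with a complete measure $\mu$ such that the compactly supported continuous functions are dense in $L^1(X,\mu)$, and $\rho:X\times X\to[0,\infty)$ is a quasi-metric: (i) $\rho(x,y)=0$ iff $x=y$; (ii) there is $a_1>0$ with $\rho(x,y)\le a_1(\rho(x,z)+\rho(z,y))$ for all $x,y,z\in X$; (iii) there is $a_0>0$ with $\rho(x,y)\le a_0\rho(y,x)$ for all $x,y\in X$. Balls $B(x,r)=\{y\in X:\rho(x,y)<r\}$ are measurable with $0<\mu(B(x,r))<\infty$ for all $x\in X$, $r>0$; for every neighborhood $V$ of $x\in X$ there is $r>0$ with $B(x,r)\subset V$; $\mu\{x\}=0$ for all $x\in X$; $d:=\operatorname{diam}(X)=\sup\{\rho(x,y):x,y\in X\}<\infty$; $B(x,R)\setminus B(x,r)\ne\emptyset$ for all $x\in X$ and $0<r<R<d$; and $\mu$ is doubling: there is $c>0$ with $\mu(B(x,2r))\le c\,\mu(B(x,r))$ for all $x\in X$, $r>0$. Grand Morrey space. For $1<s<\infty$, $\theta>0$, $0\le\lambda<1$, $L^{s),\theta,\lambda}(X,\mu)$ is the class of measurable $f:X\to\mathbb{R}$ for which $$\|f\|_{L^{s),\theta,\lambda}(X,\mu)}=\sup_{0<\varepsilon<s-1}\ \sup_{x\in X,\ 0<r<d}\left[\frac{\varepsilon^{\theta}}{(\mu(B(x,r)))^{\lambda}}\int_{B(x,r)}|f(y)|^{s-\varepsilon}\,d\mu(y)\right]^{\frac{1}{s-\varepsilon}}<\infty .$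$
   Formalization: The norm bound is proved in general, with lower integrals if T_α f is not measurable; that T_α f is measurable and so lies in the target space is stated only when ρ is measurable for the completed product measure, since under the listed assumptions alone T_α f can be non-measurable. *)

theory Defs
  imports "HOL-Analysis.Analysis"
begin

definition qball :: "('a \<Rightarrow> 'a \<Rightarrow> real) \<Rightarrow> 'a \<Rightarrow> real \<Rightarrow> 'a set" where
  "qball \<rho> x r = {y. \<rho> x y < r}"

definition qdiam :: "('a \<Rightarrow> 'a \<Rightarrow> real) \<Rightarrow> real" where
  "qdiam \<rho> = (SUP (x, y)\<in>UNIV. \<rho> x y)"

definition compactly_supported_continuous :: "('a::topological_space \<Rightarrow> real) \<Rightarrow> bool" where
  "compactly_supported_continuous g \<longleftrightarrow>
     continuous_on UNIV g \<and> compact (closure (support_on UNIV g))"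

text \<open>
  The underlying set \<open>X\<close> is the whole type. The topology is the one of the type class; it is
  linked to \<open>\<rho>\<close> only through \<open>nbhd_contains_ball\<close>. In particular balls need not be open, and
  \<open>\<rho>\<close> is not assumed to be jointly measurable.
\<close>

locale homogeneous_type_space = complete_measure M
  for M :: "'a::topological_space measure" +
  fixes \<rho> :: "'a \<Rightarrow> 'a \<Rightarrow> real"
  assumes space_UNIV: "space M = UNIV"
    and Cc_integrable: "\<And>g. compactly_supported_continuous g \<Longrightarrow> integrable M g"
    and Cc_dense: "\<And>f e. integrable M f \<Longrightarrow> 0 < e \<Longrightarrow>
      \<exists>g. compactly_supported_continuous g \<and> (\<integral>x. \<bar>f x - g x\<bar> \<partial>M) < e"
    and rho_nonneg: "\<And>x y. 0 \<le> \<rho> x y"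
    and rho_eq_0_iff: "\<And>x y. \<rho> x y = 0 \<longleftrightarrow> x = y"
    and quasi_triangle: "\<exists>a1>0. \<forall>x y z. \<rho> x y \<le> a1 * (\<rho> x z + \<rho> z y)"
    and quasi_symmetric: "\<exists>a0>0. \<forall>x y. \<rho> x y \<le> a0 * \<rho> y x"
    and ball_measurable: "\<And>x r. 0 < r \<Longrightarrow> qball \<rho> x r \<in> sets M"
    and ball_positive: "\<And>x r. 0 < r \<Longrightarrow> 0 < emeasure M (qball \<rho> x r)"
    and ball_finite: "\<And>x r. 0 < r \<Longrightarrow> emeasure M (qball \<rho> x r) < \<infinity>"
    and nbhd_contains_ball: "\<And>x V. open V \<Longrightarrow> x \<in> V \<Longrightarrow> \<exists>r>0. qball \<rho> x r \<subseteq> V"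
    and point_null: "\<And>x. emeasure M {x} = 0"
    and diam_finite: "bdd_above (range (\<lambda>(x, y). \<rho> x y))"
    and annulus_nonempty: "\<And>x r R. 0 < r \<Longrightarrow> r < R \<Longrightarrow> R < qdiam \<rho> \<Longrightarrow>
      qball \<rho> x R - qball \<rho> x r \<noteq> {}"
    and doubling: "\<exists>c>0. \<forall>x. \<forall>r>0.
      measure M (qball \<rho> x (2 * r)) \<le> c * measure M (qball \<rho> x r)"

definition powr_ennreal :: "ennreal \<Rightarrow> real \<Rightarrow> ennreal" where
  "powr_ennreal a t = (if a = \<infinity> then \<infinity> else ennreal (enn2real a powr t))"

text \<open>
  The norm takes values in \<open>[0, \<infinity>]\<close> and is defined for every function. For a non-measurable
  function, the library's \<open>nn_integral\<close> is the lower integral.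
\<close>

definition grand_morrey_norm ::
  "'a measure \<Rightarrow> ('a \<Rightarrow> 'a \<Rightarrow> real) \<Rightarrow> real \<Rightarrow> real \<Rightarrow> real \<Rightarrow> ('a \<Rightarrow> real) \<Rightarrow> ennreal" where
  "grand_morrey_norm M \<rho> s \<theta> lam f =
     (SUP \<epsilon>\<in>{0<..<s - 1}. SUP x. SUP r\<in>{0<..<qdiam \<rho>}.
        powr_ennreal
          (ennreal (\<epsilon> powr \<theta> / measure M (qball \<rho> x r) powr lam)
             * (\<integral>\<^sup>+y\<in>qball \<rho> x r. ennreal (\<bar>f y\<bar> powr (s - \<epsilon>)) \<partial>M))
          (1 / (s - \<epsilon>)))"

definition grand_morrey ::
  "'a measure \<Rightarrow> ('a \<Rightarrow> 'a \<Rightarrow> real) \<Rightarrow> real \<Rightarrow> real \<Rightarrow> real \<Rightarrow> ('a \<Rightarrow> real) set" where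
  "grand_morrey M \<rho> s \<theta> lam =
     {f \<in> borel_measurable M. grand_morrey_norm M \<rho> s \<theta> lam f < \<infinity>}"

text \<open>
  On the diagonal the denominator is \<open>0\<close> and the quotient is \<open>0\<close> by convention; single points
  are null sets.
\<close>

definition potential_integrand ::
  "'a measure \<Rightarrow> ('a \<Rightarrow> 'a \<Rightarrow> real) \<Rightarrow> real \<Rightarrow> ('a \<Rightarrow> real) \<Rightarrow> 'a \<Rightarrow> 'a \<Rightarrow> real" where
  "potential_integrand M \<rho> \<alpha> f x y =
     f y / measure M (qball \<rho> x (\<rho> x y)) powr (1 - \<alpha>)"

definition potential ::
  "'a measure \<Rightarrow> ('a \<Rightarrow> 'a \<Rightarrow> real) \<Rightarrow> real \<Rightarrow> ('a \<Rightarrow> real) \<Rightarrow> 'a \<Rightarrow> real" where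
  "potential M \<rho> \<alpha> f x = (\<integral>y. potential_integrand M \<rho> \<alpha> f x y \<partial>M)"

end

theory Submission
  imports Defs
begin

text \<open>
  Adams' argument, carried out uniformly in the exponents. If \<open>s\<close> and \<open>t\<close> satisfy
  \<open>1 / s - 1 / t = \<alpha> / (1 - lam)\<close>, then splitting the potential at a level \<open>\<tau>\<close> of
  \<open>\<mu>(B(x, \<rho>(x, y)))\<close> and optimising in \<open>\<tau>\<close> gives Hedberg's pointwise bound of
  \<open>T\<^sub>\<alpha> \<bar>f\<bar>\<close> by a constant times \<open>N powr (1 - s / t) * (Mf) powr (s / t)\<close>, where \<open>N\<close> is the Morrey
  norm of \<open>f\<close> with exponent \<open>s\<close> and \<open>Mf\<close> is the maximal function. A Vitali covering and a dyadic
  Marcinkiewicz interpolation bound \<open>Mf\<close> on Morrey spaces, with constants that are uniform for \<open>s\<close> in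
  \<open>[(p + 1) / 2, p]\<close>. For the exponent \<open>q - \<epsilon>\<close> on the target side with \<open>\<epsilon>\<close> small, the exponent \<open>s\<close>
  corresponding to \<open>t = q - \<epsilon>\<close> satisfies \<open>p - s \<ge> const * \<epsilon>\<close>, and \<open>\<theta>2 / q = \<theta>1 / p\<close> makes the powers
  of \<open>\<epsilon>\<close> match; the remaining \<open>\<epsilon>\<close> are reduced to a fixed small one by Hoelder's inequality.

  Since \<open>\<rho>\<close> need not be jointly measurable, neither \<open>Mf\<close> nor \<open>T\<^sub>\<alpha> f\<close> need be measurable, and lower
  integrals are not subadditive. All estimates are therefore made for measurable majorants, and
  these may depend on the ball over which one integrates.
\<close>

section \<open>Real and extended real estimates\<close>

lemma ex_dyadic_scale:
  fixes x :: real
  assumes "1 \<le> x"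
  obtains n :: nat where "2 ^ n \<le> x" "x < 2 ^ Suc n"
proof -
  define n where "n = (LEAST n. x < 2 ^ n)"
  have ex: "\<exists>n. x < 2 ^ n"
    by (rule real_arch_pow) simp
  have n: "x < 2 ^ n"
    unfolding n_def using ex by (rule LeastI_ex)
  with assms have "n \<noteq> 0" by (cases n) auto
  then obtain k where k: "n = Suc k" by (cases n) auto
  have "\<not> x < 2 ^ k"
    using not_less_Least[of k "\<lambda>n. x < 2 ^ n"] k unfolding n_def by simp
  then show ?thesis
    using n k that[of k] by auto
qed

text \<open>Below the threshold \<open>K\<close> the first term suffices; above it
  \<open>y powr (a - b)\<close> is at most \<open>K powr (a - b)\<close>, since
  \<open>a \<le> b\<close>. A suitable choice of \<open>K\<close> after integration turns this into
  a form of Hoelder's inequality.\<close>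

lemma powr_le_split:
  fixes y K a b :: real
  assumes "0 \<le> y" "0 < K" "0 \<le> a" "a \<le> b"
  shows "y powr a \<le> K powr a + y powr b * K powr (a - b)"
proof (cases "y \<le> K")
  case True
  then have "y powr a \<le> K powr a"
    using assms by (intro powr_mono2) auto
  then show ?thesis by (simp add: add_increasing2)
next
  case False
  have "y powr a = y powr b * y powr (a - b)"
    by (simp add: powr_add[symmetric])
  also have "\<dots> \<le> y powr b * K powr (a - b)"
    using False assms by (intro mult_left_mono powr_mono2') auto
  finally show ?thesis by (simp add: add_increasing)
qed

text \<open>A geometric series is controlled by its largest counted term, here at most
  \<open>a powr \<beta>\<close>. This is the sum over levels in the Marcinkiewicz
  interpolation.\<close>

lemma dyadic_powr_sum_le:
  fixes a b \<beta> :: real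
  assumes "0 < \<beta>" "0 < b"
  shows "(\<Sum>k<n. if b * 2 ^ k < a then (b * 2 ^ k) powr \<beta> else 0) \<le> a powr \<beta> / (1 - 2 powr - \<beta>)"
proof -
  let ?S = "\<lambda>n. \<Sum>k<n. if b * 2 ^ k < a then (b * 2 ^ k) powr \<beta> else 0"
  let ?q = "2 powr - \<beta> :: real"
  have q: "0 < ?q" "?q < 1"
    using assms by (auto simp: powr_less_one)
  have step: "(b * 2 ^ Suc n) powr \<beta> * ?q = (b * 2 ^ n) powr \<beta>" for n
    using assms by (simp add: powr_mult powr_minus field_simps)
  \<comment> \<open>The first conjunct is the geometric bound irrespective of \<open>a\<close>; it
    controls the earlier terms whenever a new term counts. A term that does not count leaves the sum
    unchanged.\<close>
  have "?S n \<le> (b * 2 ^ n) powr \<beta> * ?q / (1 - ?q) \<and> ?S n \<le> a powr \<beta> / (1 - ?q)"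
  proof (induction n)
    case 0
    then show ?case using q by simp
  next
    case (Suc n)
    let ?P = "(b * 2 ^ n) powr \<beta>"
    show ?case
    proof (cases "b * 2 ^ n < a")
      case True
      then have "?S (Suc n) = ?S n + ?P" by simp
      also have "\<dots> \<le> ?P * ?q / (1 - ?q) + ?P"
        using Suc by simp
      also have "\<dots> = (?P * ?q + ?P * (1 - ?q)) / (1 - ?q)"
        using q(2) assms by (simp add: add_divide_distrib)
      also have "\<dots> = ?P / (1 - ?q)"
        by (simp add: right_diff_distrib)
      finally have *: "?S (Suc n) \<le> ?P / (1 - ?q)" .
      moreover have "?P / (1 - ?q) \<le> a powr \<beta> / (1 - ?q)"
        using True assms q by (intro divide_right_mono powr_mono2) auto
      ultimately show ?thesis
        unfolding step by linarith
    next
      case False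
      have "?P * ?q / (1 - ?q) \<le> ?P / (1 - ?q)"
        using q by (intro divide_right_mono) (auto simp: mult_left_le)
      then show ?thesis
        unfolding step using Suc False by auto
    qed
  qed
  then show ?thesis by blast
qed

lemma le_suminf_ennreal: "f i \<le> (\<Sum>i. f i :: ennreal)"
  using ennreal_suminf_lessD[of f] by (meson leI less_irrefl)

lemma suminf_ennreal_le:
  assumes "\<And>n. (\<Sum>k<n. f k) \<le> (x :: ennreal)"
  shows "(\<Sum>k. f k) \<le> x"
  unfolding suminf_eq_SUP by (rule SUP_least) (rule assms)

lemma powr_2_power: "(2 ^ n :: real) powr b = (2 powr b) ^ n"
  by (simp add: powr_realpow[symmetric] powr_powr mult.commute)

lemma suminf_ennreal_geometric:
  fixes K x :: real
  assumes "0 \<le> K" "0 \<le> x" "x < 1"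
  shows "(\<Sum>j. ennreal (K * x ^ j)) = ennreal (K / (1 - x))"
  using assms sums_mult[OF geometric_sums[of x], of K]
  by (intro suminf_ennreal_eq) auto

text \<open>Given the target exponent \<open>q - \<epsilon>\<close>, take \<open>t\<close> close to
  \<open>q\<close>; the relation \<open>1 / s - 1 / t = A\<close> forces
  \<open>s = t / (1 + A * t)\<close>, and then \<open>p - s\<close> is comparable to
  \<open>q - t\<close>. The positive power of \<open>\<epsilon>\<close> coming from the target norm
  absorbs the blow-up of \<open>(p - s) powr - (\<theta> / s)\<close>, with a bound independent of
  \<open>\<epsilon>\<close>.\<close>

lemma grand_exponents:
  fixes p q A \<theta> :: real
  assumes p: "1 < p" and q: "0 < q" and A: "0 < A" and pq: "1 / p - 1 / q = A" and \<theta>: "0 < \<theta>"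
  obtains Q where "0 < Q"
    and "\<And>\<epsilon>. 0 < \<epsilon> \<Longrightarrow> \<epsilon> < q - 1 \<Longrightarrow> \<exists>s t. (p + 1) / 2 \<le> s \<and> s < p \<and> 0 < t \<and> t \<le> q \<and> q - \<epsilon> \<le> t \<and>
      1 / s - 1 / t = A \<and> \<epsilon> powr (\<theta> * (1 + A * q) / (q - \<epsilon>)) * (p - s) powr - (\<theta> / s) \<le> Q"
proof -
  define D where "D = 1 + A * q"
  have D: "1 < D"
    using A q by (simp add: D_def)
  have pD: "p = q / D"
  proof -
    have "1 / p = A + 1 / q"
      using pq by simp
    also have "\<dots> = D / q"
      using q by (simp add: D_def field_simps)
    finally show ?thesis
      using p q D by (simp add: field_simps)
  qed
  have pq': "p < q"
    using mult_strict_left_mono[of 1 D p] pD p D by simp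
  \<comment> \<open>The cap on \<open>q - t\<close>: it keeps \<open>s\<close> at or above
    \<open>(p + 1) / 2\<close>, and it gives \<open>\<epsilon> \<le> 1\<close> in the case without
    truncation.\<close>
  define \<sigma> where "\<sigma> = min 1 ((p - 1) / 2)"
  have \<sigma>: "0 < \<sigma>" "\<sigma> \<le> 1" "\<sigma> \<le> (p - 1) / 2"
    unfolding \<sigma>_def using p by (simp, simp, intro min.cobounded2)
  define Q where "Q = max (D powr (2 * \<theta>)) (q powr (\<theta> * D) * (D\<^sup>2 / \<sigma>) powr \<theta>)"
  have Q: "D powr (2 * \<theta>) \<le> Q" "q powr (\<theta> * D) * (D\<^sup>2 / \<sigma>) powr \<theta> \<le> Q"
    by (auto simp: Q_def)
  have "0 < D powr (2 * \<theta>)"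
    using D by simp
  then have Q0: "0 < Q"
    using Q(1) by linarith
  have "\<exists>s t. (p + 1) / 2 \<le> s \<and> s < p \<and> 0 < t \<and> t \<le> q \<and> q - \<epsilon> \<le> t \<and>
      1 / s - 1 / t = A \<and> \<epsilon> powr (\<theta> * D / (q - \<epsilon>)) * (p - s) powr - (\<theta> / s) \<le> Q"
    if \<epsilon>: "0 < \<epsilon>" "\<epsilon> < q - 1" for \<epsilon>
  proof -
    define \<delta> where "\<delta> = min \<epsilon> \<sigma>"
    have \<delta>: "0 < \<delta>" "\<delta> \<le> \<epsilon>" "\<delta> \<le> \<sigma>"
      using \<epsilon> \<sigma> by (auto simp: \<delta>_def)
    define t where "t = q - \<delta>"
    have t: "1 < t" "t < q" "q - \<epsilon> \<le> t"
      using \<delta> \<epsilon> by (auto simp: t_def)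
    define B where "B = 1 + A * t"
    have B: "1 < B" "B < D"
      using A t by (auto simp: B_def D_def)
    define s where "s = t / B"
    have st: "1 / s = 1 / t + A"
      using t B by (simp add: s_def B_def field_simps)
    have diff: "p - s = \<delta> / (D * B)"
    proof -
      have "p - s = (q * B - t * D) / (D * B)"
        using B D by (simp add: pD s_def field_simps)
      also have "q * B - t * D = \<delta>"
        by (simp add: B_def D_def t_def algebra_simps)
      finally show ?thesis .
    qed
    have "1 * 1 \<le> D * B" "D * B \<le> D * D"
      using B D by (intro mult_mono; simp)+
    then have DB: "1 \<le> D * B" "D * B \<le> D\<^sup>2"
      by (simp_all add: power2_eq_square)
    have ps: "p - s \<le> \<delta>" "\<delta> / D\<^sup>2 \<le> p - s" "0 < p - s"
    proof -
      show "p - s \<le> \<delta>"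
        unfolding diff using \<delta> DB by (simp add: divide_le_eq mult_left_mono[of 1 _ \<delta>, simplified])
      show "\<delta> / D\<^sup>2 \<le> p - s"
        unfolding diff using \<delta> DB by (intro divide_left_mono mult_pos_pos) (use D B in auto)
      show "0 < p - s"
        unfolding diff using \<delta> DB by simp
    qed
    have s: "(p + 1) / 2 \<le> s"
      using ps \<delta> \<sigma> by (simp add: field_simps)
    then have s1: "1 \<le> s"
      using p by simp
    have \<theta>s: "0 < \<theta> / s" "\<theta> / s \<le> \<theta>"
      using \<theta> s1 by (auto simp: divide_le_eq mult_left_mono[of 1 s \<theta>, simplified])
    have "(p - s) powr - (\<theta> / s) \<le> (\<delta> / D\<^sup>2) powr - (\<theta> / s)"
      using ps \<delta> D \<theta>s by (intro powr_mono2') auto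
    have "\<epsilon> powr (\<theta> * D / (q - \<epsilon>)) * (p - s) powr - (\<theta> / s) \<le> Q"
    proof (cases "\<epsilon> \<le> \<sigma>")
      case True
      then have \<delta>\<epsilon>: "\<delta> = \<epsilon>" and t_eq: "q - \<epsilon> = t"
        by (auto simp: \<delta>_def t_def)
      \<comment> \<open>Because \<open>B < D\<close>, the net power of \<open>\<epsilon>\<close> in
        the product is nonnegative; as \<open>\<epsilon> \<le> 1\<close>, it contributes at most
        1.\<close>
      have "\<theta> / s = \<theta> * B / t"
        using t B by (simp add: s_def)
      also have "\<dots> \<le> \<theta> * D / t"
        using \<theta> t B by (intro divide_right_mono mult_left_mono) auto
      finally have e: "\<theta> / s \<le> \<theta> * D / t" .
      have "(p - s) powr - (\<theta> / s) \<le> (\<epsilon> / D\<^sup>2) powr - (\<theta> / s)"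
        using ps \<epsilon> D \<theta>s \<delta>\<epsilon> by (intro powr_mono2') auto
      also have "\<dots> = \<epsilon> powr - (\<theta> / s) * (D\<^sup>2) powr (\<theta> / s)"
        using \<epsilon> D by (simp add: powr_divide powr_minus field_simps)
      finally have "\<epsilon> powr (\<theta> * D / t) * (p - s) powr - (\<theta> / s) \<le>
          \<epsilon> powr (\<theta> * D / t) * (\<epsilon> powr - (\<theta> / s) * (D\<^sup>2) powr (\<theta> / s))"
        by (intro mult_left_mono) auto
      also have "\<dots> = \<epsilon> powr (\<theta> * D / t - \<theta> / s) * (D\<^sup>2) powr (\<theta> / s)"
        using powr_add[of \<epsilon> "\<theta> * D / t" "- (\<theta> / s)"] by simp
      also have "\<dots> \<le> 1 * (D\<^sup>2) powr \<theta>"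
        using e \<epsilon> True \<sigma> \<theta>s D by (intro mult_mono powr_le1 powr_mono) (auto simp: one_le_power)
      also have "\<dots> = D powr (2 * \<theta>)"
        using D powr_powr[of D 2 \<theta>] by simp
      also note Q(1)
      finally show ?thesis
        by (simp add: t_eq)
    next
      \<comment> \<open>Now \<open>\<delta> = \<sigma>\<close> is fixed, so \<open>p - s\<close> is
        bounded away from 0. The power of \<open>\<epsilon>\<close> is harmless since
        \<open>\<epsilon> < q\<close> and \<open>q - \<epsilon> > 1\<close>.\<close>
      case False
      then have \<delta>\<sigma>: "\<delta> = \<sigma>"
        by (auto simp: \<delta>_def)
      have "(p - s) powr - (\<theta> / s) \<le> (\<sigma> / D\<^sup>2) powr - (\<theta> / s)"
        using ps \<sigma> D \<theta>s \<delta>\<sigma> by (intro powr_mono2') auto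
      also have "\<dots> = (D\<^sup>2 / \<sigma>) powr (\<theta> / s)"
        using \<sigma> D by (simp add: powr_divide powr_minus field_simps)
      also have "\<dots> \<le> (D\<^sup>2 / \<sigma>) powr \<theta>"
      proof (intro powr_mono \<theta>s)
        have "1 \<le> D\<^sup>2"
          using D by (simp add: one_le_power)
        then show "1 \<le> D\<^sup>2 / \<sigma>"
          using \<sigma> by (simp add: le_divide_eq)
      qed
      finally have 1: "(p - s) powr - (\<theta> / s) \<le> (D\<^sup>2 / \<sigma>) powr \<theta>" .
      have "\<epsilon> powr (\<theta> * D / (q - \<epsilon>)) \<le> q powr (\<theta> * D / (q - \<epsilon>))"
        using \<epsilon> \<theta> D by (intro powr_mono2) auto
      also have "\<dots> \<le> q powr (\<theta> * D)"
        using \<epsilon> \<theta> D p pq' by (intro powr_mono) (auto simp: divide_le_eq mult_left_mono[of 1 _ "\<theta> * D", simplified])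
      finally have "\<epsilon> powr (\<theta> * D / (q - \<epsilon>)) * (p - s) powr - (\<theta> / s) \<le>
          q powr (\<theta> * D) * (D\<^sup>2 / \<sigma>) powr \<theta>"
        using 1 by (intro mult_mono) auto
      with Q(2) show ?thesis by linarith
    qed
    then show ?thesis
      using s ps t st by (intro exI[of _ s] exI[of _ t]) auto
  qed
  then show ?thesis
    unfolding D_def by (intro that[OF Q0]) (auto simp: D_def)
qed

lemma powr_ennreal_le_ennreal:
  assumes "a \<le> ennreal b" "0 \<le> b" "0 \<le> e"
  shows "powr_ennreal a e \<le> ennreal (b powr e)"
proof -
  have "a \<noteq> \<infinity>"
    using assms(1) by (auto simp: top_unique)
  moreover have "enn2real a \<le> b"
    using assms(1,2) by (rule enn2real_leI[rotated])
  ultimately show ?thesis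
    using assms(3) by (simp add: powr_ennreal_def ennreal_leI powr_mono2)
qed

lemma le_ennreal_of_powr_ennreal:
  assumes "powr_ennreal a (1 / s) \<le> ennreal N" "0 \<le> N" "0 < s"
  shows "a \<le> ennreal (N powr s)"
proof -
  have fin: "a \<noteq> \<infinity>"
    using assms(1) by (auto simp: powr_ennreal_def top_unique split: if_splits)
  then obtain b where b: "a = ennreal b" "0 \<le> b"
    by (cases a) auto
  then have "b powr (1 / s) \<le> N"
    using assms(1,2) by (simp add: powr_ennreal_def)
  then have "(b powr (1 / s)) powr s \<le> N powr s"
    using assms(3) by (intro powr_mono2) auto
  then show ?thesis
    using b assms(3) by (simp add: powr_powr ennreal_leI)
qed

text \<open>Continuity from below along an enumeration of \<open>D\<close>; it reduces the Vitali
  cover to finite subfamilies.\<close>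

lemma emeasure_UN_countable_le:
  assumes "countable D" and A: "\<And>i. i \<in> D \<Longrightarrow> A i \<in> sets N"
    and le: "\<And>F. finite F \<Longrightarrow> F \<subseteq> D \<Longrightarrow> emeasure N (\<Union>i\<in>F. A i) \<le> K"
  shows "emeasure N (\<Union>i\<in>D. A i) \<le> K"
proof (cases "D = {}")
  case False
  define U where "U n = (\<Union>i\<in>from_nat_into D ` {..n}. A i)" for n :: nat
  have in_D: "from_nat_into D n \<in> D" for n
    using False by (rule from_nat_into)
  have "(\<Union>i\<in>D. A i) = (\<Union>n. U n)"
  proof
    show "(\<Union>i\<in>D. A i) \<subseteq> (\<Union>n. U n)"
    proof
      fix x assume "x \<in> (\<Union>i\<in>D. A i)"
      then obtain i where "i \<in> D" "x \<in> A i" by auto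
      moreover from this obtain n where "i = from_nat_into D n"
        using from_nat_into_surj[OF assms(1)] by metis
      ultimately show "x \<in> (\<Union>n. U n)" by (auto simp: U_def)
    qed
    show "(\<Union>n. U n) \<subseteq> (\<Union>i\<in>D. A i)"
      using in_D unfolding U_def by blast
  qed
  then have "emeasure N (\<Union>i\<in>D. A i) = emeasure N (\<Union>n. U n)" by simp
  also have "\<dots> = (SUP n. emeasure N (U n))"
  proof (rule SUP_emeasure_incseq[symmetric])
    show "range U \<subseteq> sets N"
      using A in_D by (auto simp: U_def)
    show "incseq U"
      by (intro monoI) (fastforce simp: U_def)
  qed
  also have "\<dots> \<le> K"
    unfolding U_def using in_D by (intro SUP_least le) auto
  finally show ?thesis .
qed simp

context homogeneous_type_space
begin

section \<open>Balls and doubling\<close>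

lemma rho_le_qdiam: "\<rho> x y \<le> qdiam \<rho>"
  unfolding qdiam_def using cSUP_upper[OF _ diam_finite, of "(x, y)"] by simp

lemma qball_eq_UNIV: "qdiam \<rho> < r \<Longrightarrow> qball \<rho> x r = UNIV"
  using rho_le_qdiam le_less_trans by (fastforce simp: qball_def)

lemma qball_empty: "r \<le> 0 \<Longrightarrow> qball \<rho> x r = {}"
  using rho_nonneg[of x] by (auto simp: qball_def not_less intro: order_trans)

lemma qball_sets [measurable]: "qball \<rho> x r \<in> sets M"
  by (cases "0 < r") (auto simp: ball_measurable qball_empty)

lemma qball_mono: "r \<le> s \<Longrightarrow> qball \<rho> x r \<subseteq> qball \<rho> x s"
  by (auto simp: qball_def)

lemma qdiam_nonneg: "0 \<le> qdiam \<rho>"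
  using rho_nonneg rho_le_qdiam order.trans by blast

text \<open>The diameter is finite, so a single ball is the whole space.\<close>

lemma finite_measure_M: "finite_measure M"
proof
  have "emeasure M (qball \<rho> undefined (qdiam \<rho> + 1)) < \<infinity>"
    using qdiam_nonneg by (intro ball_finite) simp
  then show "emeasure M (space M) \<noteq> \<infinity>"
    by (simp add: qball_eq_UNIV space_UNIV)
qed

sublocale finite_measure M
  by (rule finite_measure_M)

lemma measure_qball_pos: "0 < r \<Longrightarrow> 0 < measure M (qball \<rho> x r)"
  using ball_positive[of r x] by (simp add: measure_def enn2real_positive_iff emeasure_finite
      less_top[symmetric])

lemma measure_qball_nonpos: "r \<le> 0 \<Longrightarrow> measure M (qball \<rho> x r) = 0"
  by (simp add: qball_empty)

lemma measure_qball_mono: "r \<le> s \<Longrightarrow> measure M (qball \<rho> x r) \<le> measure M (qball \<rho> x s)"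
  by (intro finite_measure_mono qball_mono) auto

lemma measure_qball_le: "measure M (qball \<rho> x r) \<le> measure M UNIV"
  using bounded_measure[of "qball \<rho> x r"] by (simp add: space_UNIV)

lemma measure_UNIV_pos: "0 < measure M UNIV"
  using measure_qball_pos[of 1 undefined] measure_qball_le[of undefined 1] by linarith

text \<open>Diameter 0 would leave a single point, which is a null set, whereas balls have positive
  measure.\<close>

lemma qdiam_pos: "0 < qdiam \<rho>"
proof (rule ccontr)
  assume "\<not> 0 < qdiam \<rho>"
  then have "\<rho> x y = 0" for x y
    using rho_le_qdiam[of x y] rho_nonneg[of x y] by linarith
  then have "UNIV = {undefined :: 'a}"
    using rho_eq_0_iff by auto
  then show False
    using measure_UNIV_pos point_null[of undefined] by (simp add: measure_def)
qed

lemma borel_measurable_rho [measurable]: "\<rho> x \<in> borel_measurable M"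
  unfolding borel_measurable_iff_less
  using qball_sets by (simp add: qball_def space_UNIV)

lemma borel_measurable_measure_qball [measurable]:
  "(\<lambda>t. measure M (qball \<rho> x t)) \<in> borel_measurable borel"
  by (intro borel_measurable_mono) (auto intro!: monoI measure_qball_mono)

lemma doubling_pow:
  "\<exists>c\<ge>1. \<forall>x r. 0 < r \<longrightarrow> measure M (qball \<rho> x (2 * r)) \<le> c * measure M (qball \<rho> x r)"
proof -
  obtain c where c: "\<And>x r. 0 < r \<Longrightarrow>
      measure M (qball \<rho> x (2 * r)) \<le> c * measure M (qball \<rho> x r)"
    using doubling by blast
  have "measure M (qball \<rho> x (2 * r)) \<le> max 1 c * measure M (qball \<rho> x r)" if "0 < r" for x r
  proof -
    have "c * measure M (qball \<rho> x r) \<le> max 1 c * measure M (qball \<rho> x r)"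
      by (intro mult_right_mono) auto
    then show ?thesis
      using c[OF that, of x] by linarith
  qed
  then show ?thesis by (intro exI[of _ "max 1 c"]) auto
qed

text \<open>Doubling is iterated until \<open>2 ^ n\<close> exceeds \<open>\<kappa>\<close>.\<close>

lemma dilation:
  "\<exists>c\<ge>1. \<forall>x r. 0 < r \<longrightarrow> measure M (qball \<rho> x (\<kappa> * r)) \<le> c * measure M (qball \<rho> x r)"
proof -
  obtain c where c: "1 \<le> c" "\<And>x r. 0 < r \<Longrightarrow>
      measure M (qball \<rho> x (2 * r)) \<le> c * measure M (qball \<rho> x r)"
    using doubling_pow by blast
  have *: "measure M (qball \<rho> x (2 ^ n * r)) \<le> c ^ n * measure M (qball \<rho> x r)"
    if "0 < r" for x r n
  proof (induction n)
    case (Suc n)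
    have "measure M (qball \<rho> x (2 ^ Suc n * r)) \<le> c * measure M (qball \<rho> x (2 ^ n * r))"
      using c(2)[of "2 ^ n * r" x] that by (simp add: mult.assoc)
    also have "\<dots> \<le> c * (c ^ n * measure M (qball \<rho> x r))"
      using c(1) Suc by (intro mult_left_mono) auto
    finally show ?case by (simp add: mult.assoc)
  qed simp
  obtain n where n: "\<kappa> < 2 ^ n"
    using real_arch_pow[of 2 \<kappa>] by auto
  have "measure M (qball \<rho> x (\<kappa> * r)) \<le> c ^ n * measure M (qball \<rho> x r)" if "0 < r" for x r
    using *[OF that, of x n] measure_qball_mono[of "\<kappa> * r" "2 ^ n * r" x] n that
    by (simp add: mult_right_mono less_imp_le)
  moreover have "1 \<le> c ^ n"
    using c(1) by simp
  ultimately show ?thesis by blast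
qed

text \<open>Sublevel sets of the measure of \<open>B(x, \<rho>(x, y))\<close> behave like balls: if
  \<open>y\<close> is a point of the set whose distance from \<open>x\<close> exceeds half the
  supremum, then twice that distance is a radius covering the set, and doubling controls its
  measure. The alternative \<open>{x}\<close> covers the sets without a point at positive
  distance.\<close>

lemma sublevel_subset_qball:
  "\<exists>c\<ge>1. \<forall>x \<sigma>. {y. measure M (qball \<rho> x (\<rho> x y)) \<le> \<sigma>} \<subseteq> {x} \<or>
     (\<exists>r>0. {y. measure M (qball \<rho> x (\<rho> x y)) \<le> \<sigma>} \<subseteq> qball \<rho> x r \<and>
            measure M (qball \<rho> x r) \<le> c * \<sigma>)"
proof -
  obtain c where c: "1 \<le> c" "\<And>x r. 0 < r \<Longrightarrow>
      measure M (qball \<rho> x (2 * r)) \<le> c * measure M (qball \<rho> x r)"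
    using doubling_pow by blast
  have "\<exists>r>0. F \<subseteq> qball \<rho> x r \<and> measure M (qball \<rho> x r) \<le> c * \<sigma>"
    if F: "F = {y. measure M (qball \<rho> x (\<rho> x y)) \<le> \<sigma>}" and "\<not> F \<subseteq> {x}" for x \<sigma> F
  proof -
    from that(2) obtain z where z: "z \<in> F" "z \<noteq> x" by auto
    define R where "R = Sup (\<rho> x ` F)"
    have bdd: "bdd_above (\<rho> x ` F)"
      using rho_le_qdiam by (auto intro!: bdd_aboveI)
    have R: "\<rho> x y \<le> R" if "y \<in> F" for y
      unfolding R_def using bdd that by (intro cSup_upper) auto
    have "0 < \<rho> x z"
      using z rho_nonneg[of x z] rho_eq_0_iff[of x z] by auto
    with R[OF z(1)] have "0 < R" "R / 2 < R" by auto
    then obtain y where y: "y \<in> F" "R / 2 < \<rho> x y"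
      using less_cSup_iff[OF _ bdd, of "R / 2"] z(1) unfolding R_def by auto
    have pos: "0 < \<rho> x y"
      using y \<open>0 < R\<close> by linarith
    have "F \<subseteq> qball \<rho> x (2 * \<rho> x y)"
    proof
      fix w assume "w \<in> F"
      then show "w \<in> qball \<rho> x (2 * \<rho> x y)"
        using R[of w] y(2) by (simp add: qball_def)
    qed
    moreover have "measure M (qball \<rho> x (2 * \<rho> x y)) \<le> c * \<sigma>"
    proof -
      have "c * measure M (qball \<rho> x (\<rho> x y)) \<le> c * \<sigma>"
        using y(1) c(1) unfolding F by (intro mult_left_mono) auto
      then show ?thesis
        using c(2)[OF pos, of x] by linarith
    qed
    ultimately show ?thesis
      using pos by (intro exI[of _ "2 * \<rho> x y"]) auto
  qed
  then have "\<forall>x \<sigma>. {y. measure M (qball \<rho> x (\<rho> x y)) \<le> \<sigma>} \<subseteq> {x} \<or>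
     (\<exists>r>0. {y. measure M (qball \<rho> x (\<rho> x y)) \<le> \<sigma>} \<subseteq> qball \<rho> x r \<and>
            measure M (qball \<rho> x r) \<le> c * \<sigma>)"
    by blast
  then show ?thesis
    using c(1) by blast
qed

lemma quasi_metric_constant:
  "\<exists>a\<ge>1. \<forall>x y z. \<rho> x y \<le> a * (\<rho> x z + \<rho> z y) \<and> \<rho> x y \<le> a * \<rho> y x"
proof -
  obtain a1 where a1: "\<And>x y z. \<rho> x y \<le> a1 * (\<rho> x z + \<rho> z y)"
    using quasi_triangle by blast
  obtain a0 where a0: "\<And>x y. \<rho> x y \<le> a0 * \<rho> y x"
    using quasi_symmetric by blast
  define a where "a = max 1 (max a0 a1)"
  have a: "1 \<le> a" "a0 \<le> a" "a1 \<le> a" by (auto simp: a_def)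
  have "\<rho> x y \<le> a * (\<rho> x z + \<rho> z y)" for x y z
    using a1[of x y z] mult_right_mono[OF a(3), of "\<rho> x z + \<rho> z y"]
      rho_nonneg[of x z] rho_nonneg[of z y] by linarith
  moreover have "\<rho> x y \<le> a * \<rho> y x" for x y
    using a0[of x y] mult_right_mono[OF a(2), of "\<rho> y x"] rho_nonneg[of y x] by linarith
  ultimately show ?thesis using a(1) by blast
qed

section \<open>The maximal function\<close>

text \<open>The family may be uncountable and the radii need not attain a supremum, so a maximal
  disjoint subfamily is taken by Zorn's lemma, with the comparison of radii built into the
  order.\<close>

lemma vitali_selection:
  assumes "bdd_above (R ` E)" and pos: "\<And>x. x \<in> E \<Longrightarrow> 0 < R x"
  obtains D where "D \<subseteq> E" and "disjoint_family_on (\<lambda>x. qball \<rho> x (R x)) D"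
    and "\<And>x. x \<in> E \<Longrightarrow> \<exists>y\<in>D. qball \<rho> x (R x) \<inter> qball \<rho> y (R y) \<noteq> {} \<and> R x \<le> 2 * R y"
proof -
  let ?B = "\<lambda>x. qball \<rho> x (R x)"
  \<comment> \<open>The last clause says that a ball meeting the family also meets a member of at
    least half its radius. It survives unions of chains, and maximality then only has to show that
    every ball meets the family.\<close>
  define adm where "adm D \<longleftrightarrow> D \<subseteq> E \<and> disjoint_family_on ?B D \<and>
      (\<forall>x\<in>E. (\<exists>y\<in>D. ?B x \<inter> ?B y \<noteq> {}) \<longrightarrow> (\<exists>y\<in>D. ?B x \<inter> ?B y \<noteq> {} \<and> R x \<le> 2 * R y))" for D
  have "\<exists>D\<in>{D. adm D}. \<forall>X\<in>{D. adm D}. D \<subseteq> X \<longrightarrow> X = D"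
  proof (rule subset_Zorn')
    fix C assume C: "subset.chain {D. adm D} C"
    have "adm (\<Union>C)"
      unfolding adm_def
    proof (intro conjI ballI impI)
      show "\<Union>C \<subseteq> E"
        using C by (auto simp: subset.chain_def adm_def)
      show "disjoint_family_on ?B (\<Union>C)"
        unfolding disjoint_family_on_def
      proof (intro ballI impI)
        fix x y assume xy: "x \<in> \<Union>C" "y \<in> \<Union>C" "x \<noteq> y"
        then obtain X Y where "X \<in> C" "Y \<in> C" "x \<in> X" "y \<in> Y" by auto
        moreover from this have "X \<subseteq> Y \<or> Y \<subseteq> X"
          using C by (auto simp: subset_chain_def)
        ultimately obtain Z where "Z \<in> C" "x \<in> Z" "y \<in> Z" by auto
        then show "?B x \<inter> ?B y = {}"
          using C xy(3) by (auto simp: subset.chain_def adm_def disjoint_family_on_def)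
      qed
      fix x assume x: "x \<in> E" "\<exists>y\<in>\<Union>C. ?B x \<inter> ?B y \<noteq> {}"
      then obtain X where X: "X \<in> C" "\<exists>y\<in>X. ?B x \<inter> ?B y \<noteq> {}" by auto
      then have "adm X"
        using C by (auto simp: subset.chain_def)
      then have "\<exists>y\<in>X. ?B x \<inter> ?B y \<noteq> {} \<and> R x \<le> 2 * R y"
        using x(1) X(2) by (simp add: adm_def)
      then show "\<exists>y\<in>\<Union>C. ?B x \<inter> ?B y \<noteq> {} \<and> R x \<le> 2 * R y"
        using X(1) by (auto intro: bexI)
    qed
    then show "\<Union>C \<in> {D. adm D}" by simp
  qed
  then obtain D where D: "adm D" and max: "\<And>X. adm X \<Longrightarrow> D \<subseteq> X \<Longrightarrow> X = D" by auto
  have meets: "\<exists>y\<in>D. ?B x \<inter> ?B y \<noteq> {}" if x: "x \<in> E" for x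
  proof (rule ccontr)
    assume no: "\<not> ?thesis"
    \<comment> \<open>If some ball misses the whole family, adding one whose radius exceeds half the
      supremum among the missed balls keeps admissibility: each missed ball meeting it has at most
      twice its radius. This contradicts maximality.\<close>
    define F where "F = {z\<in>E. \<forall>y\<in>D. ?B z \<inter> ?B y = {}}"
    have "x \<in> F"
      using x no by (auto simp: F_def)
    have bdd: "bdd_above (R ` F)"
      using assms(1) by (rule bdd_above_mono) (auto simp: F_def)
    have up: "R z \<le> Sup (R ` F)" if "z \<in> F" for z
      using bdd that by (intro cSup_upper) auto
    have "0 < Sup (R ` F)"
      using up[OF \<open>x \<in> F\<close>] pos[OF x] by linarith
    then have "Sup (R ` F) / 2 < Sup (R ` F)" by simp
    then obtain w where w: "w \<in> F" "Sup (R ` F) / 2 < R w"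
      using less_cSup_iff[OF _ bdd, of "Sup (R ` F) / 2"] \<open>x \<in> F\<close> by auto
    have wE: "w \<in> E" and wD: "\<And>y. y \<in> D \<Longrightarrow> ?B w \<inter> ?B y = {}"
      using w by (auto simp: F_def)
    have "adm (insert w D)"
      unfolding adm_def
    proof (intro conjI ballI impI)
      show "insert w D \<subseteq> E"
        using D wE by (auto simp: adm_def)
      show "disjoint_family_on ?B (insert w D)"
        using D wD unfolding adm_def disjoint_family_on_def by (metis insert_iff inf_commute)
      fix z assume z: "z \<in> E" "\<exists>y\<in>insert w D. ?B z \<inter> ?B y \<noteq> {}"
      show "\<exists>y\<in>insert w D. ?B z \<inter> ?B y \<noteq> {} \<and> R z \<le> 2 * R y"
      proof (cases "z \<in> F")
        case True
        then have "?B z \<inter> ?B w \<noteq> {}"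
          using z by (auto simp: F_def)
        moreover have "R z \<le> 2 * R w"
          using up[OF True] w(2) by linarith
        ultimately show ?thesis by blast
      next
        case False
        then have "\<exists>y\<in>D. ?B z \<inter> ?B y \<noteq> {}"
          using z(1) by (auto simp: F_def)
        then have "\<exists>y\<in>D. ?B z \<inter> ?B y \<noteq> {} \<and> R z \<le> 2 * R y"
          using D z(1) by (simp add: adm_def)
        then show ?thesis by (rule bexE) (rule bexI, auto)
      qed
    qed
    then have "insert w D = D"
      by (intro max) auto
    then have "w \<in> D" by auto
    then have "?B w = {}"
      using wD by blast
    moreover have "w \<in> ?B w"
      using pos[OF wE] rho_eq_0_iff[of w w] by (auto simp: qball_def)
    ultimately show False by blast
  qed
  show ?thesis
  proof
    show "D \<subseteq> E" "disjoint_family_on ?B D"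
      using D by (auto simp: adm_def)
    show "\<exists>y\<in>D. ?B x \<inter> ?B y \<noteq> {} \<and> R x \<le> 2 * R y" if "x \<in> E" for x
      using D meets[OF that] that by (simp add: adm_def)
  qed
qed

text \<open>Disjoint sets of positive measure in a finite measure space have summable measures, so
  there are only countably many.\<close>

lemma countable_disjoint_qballs:
  assumes disj: "disjoint_family_on (\<lambda>x. qball \<rho> x (R x)) D" and pos: "\<And>x. x \<in> D \<Longrightarrow> 0 < R x"
  shows "countable D"
proof -
  have "(\<lambda>x. measure M (qball \<rho> x (R x))) summable_on D"
  proof (rule nonneg_bdd_above_summable_on)
    have "(\<Sum>x\<in>F. measure M (qball \<rho> x (R x))) \<le> measure M UNIV" if "F \<subseteq> D" "finite F" for F
    proof -
      have "(\<Sum>x\<in>F. measure M (qball \<rho> x (R x))) = measure M (\<Union>x\<in>F. qball \<rho> x (R x))"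
        using that disj
        by (intro finite_measure_finite_Union[symmetric]) (auto intro: disjoint_family_on_mono)
      also have "\<dots> \<le> measure M UNIV"
        using bounded_measure by (simp add: space_UNIV)
      finally show ?thesis .
    qed
    then show "bdd_above (sum (\<lambda>x. measure M (qball \<rho> x (R x))) ` {F. F \<subseteq> D \<and> finite F})"
      by (auto intro!: bdd_aboveI)
  qed simp
  then have "countable {x \<in> D. measure M (qball \<rho> x (R x)) \<noteq> 0}"
    by (rule summable_countable_real)
  also have "{x \<in> D. measure M (qball \<rho> x (R x)) \<noteq> 0} = D"
  proof -
    have "measure M (qball \<rho> x (R x)) \<noteq> 0" if "x \<in> D" for x
      using measure_qball_pos[OF pos[OF that], of x] by simp
    then show ?thesis by auto
  qed
  finally show ?thesis .
qed

text \<open>The weak (1,1) bound for the maximal function. The set where it exceeds \<open>t\<close>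
  need not be measurable, so \<open>G\<close> is a measurable cover of it, a countable union of
  enlarged Vitali balls.\<close>

lemma weak_type_maximal:
  "\<exists>C\<ge>1. \<forall>h\<in>borel_measurable M. \<forall>t>0. \<exists>G\<in>sets M.
     (\<forall>x r. 0 < r \<longrightarrow> ennreal (t * measure M (qball \<rho> x r)) < (\<integral>\<^sup>+y\<in>qball \<rho> x r. h y \<partial>M) \<longrightarrow> x \<in> G) \<and>
     emeasure M G \<le> ennreal (C / t) * (\<integral>\<^sup>+y. h y \<partial>M)"
proof -
  obtain a where a: "1 \<le> a" "\<And>x y z. \<rho> x y \<le> a * (\<rho> x z + \<rho> z y)" "\<And>x y. \<rho> x y \<le> a * \<rho> y x"
    using quasi_metric_constant by blast
  \<comment> \<open>The enlargement factor: for \<open>z\<close> in both balls,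
    \<open>\<rho> y x \<le> a * (\<rho> y z + \<rho> z x)\<close> and
    \<open>\<rho> z x \<le> a * \<rho> x z < a * (2 * R y)\<close>.\<close>
  define \<kappa> where "\<kappa> = a * (1 + 2 * a)"
  obtain C where C: "1 \<le> C" "\<And>x r. 0 < r \<Longrightarrow>
      measure M (qball \<rho> x (\<kappa> * r)) \<le> C * measure M (qball \<rho> x r)"
    using dilation[of \<kappa>] by blast
  have "\<exists>G\<in>sets M.
     (\<forall>x r. 0 < r \<longrightarrow> ennreal (t * measure M (qball \<rho> x r)) < (\<integral>\<^sup>+y\<in>qball \<rho> x r. h y \<partial>M) \<longrightarrow> x \<in> G) \<and>
     emeasure M G \<le> ennreal (C / t) * (\<integral>\<^sup>+y. h y \<partial>M)"
    if h[measurable]: "h \<in> borel_measurable M" and t: "0 < t" for h t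
  proof -
    define P where "P x r \<longleftrightarrow> 0 < r \<and>
        ennreal (t * measure M (qball \<rho> x r)) < (\<integral>\<^sup>+y\<in>qball \<rho> x r. h y \<partial>M)" for x r
    define E where "E = {x. \<exists>r. P x r}"
    \<comment> \<open>Beyond \<open>qdiam \<rho>\<close> every ball is the whole space, so large
      radii can be replaced by \<open>qdiam \<rho> + 1\<close>; the Vitali selection needs bounded
      radii.\<close>
    have small: "\<exists>r\<le>qdiam \<rho> + 1. P x r" if "x \<in> E" for x
    proof -
      from that obtain r where r: "P x r" by (auto simp: E_def)
      show ?thesis
      proof (cases "r \<le> qdiam \<rho> + 1")
        case False
        then have "P x (qdiam \<rho> + 1)"
          using r qdiam_pos by (simp add: P_def qball_eq_UNIV)
        then show ?thesis by blast
      qed (use r in blast)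
    qed
    then obtain R where R: "\<And>x. x \<in> E \<Longrightarrow> R x \<le> qdiam \<rho> + 1" "\<And>x. x \<in> E \<Longrightarrow> P x (R x)"
      by metis
    have Rpos: "0 < R x" if "x \<in> E" for x
      using R(2)[OF that] by (simp add: P_def)
    have "bdd_above (R ` E)"
      using R(1) by (auto intro!: bdd_aboveI)
    then obtain D where D: "D \<subseteq> E" "disjoint_family_on (\<lambda>x. qball \<rho> x (R x)) D"
      "\<And>x. x \<in> E \<Longrightarrow> \<exists>y\<in>D. qball \<rho> x (R x) \<inter> qball \<rho> y (R y) \<noteq> {} \<and> R x \<le> 2 * R y"
      using vitali_selection[of R E] Rpos by blast
    have cD: "countable D"
      using D Rpos by (intro countable_disjoint_qballs[of R]) auto
    define G where "G = (\<Union>x\<in>D. qball \<rho> x (\<kappa> * R x))"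
    have "G \<in> sets M"
      unfolding G_def using cD by (intro sets.countable_UN') auto
    moreover have "x \<in> G" if "0 < r"
      "ennreal (t * measure M (qball \<rho> x r)) < (\<integral>\<^sup>+y\<in>qball \<rho> x r. h y \<partial>M)" for x r
    proof -
      have "x \<in> E"
        using that by (auto simp: E_def P_def)
      from D(3)[OF this] obtain y z where y: "y \<in> D" "R x \<le> 2 * R y"
        and z: "\<rho> x z < R x" "\<rho> y z < R y" by (auto simp: qball_def)
      have "\<rho> z x \<le> a * \<rho> x z" by (rule a)
      also have "\<dots> \<le> a * (2 * R y)"
        using z y a(1) by (intro mult_left_mono) auto
      finally have "\<rho> y z + \<rho> z x < R y + a * (2 * R y)"
        using z by linarith
      then have "a * (\<rho> y z + \<rho> z x) < a * (R y + a * (2 * R y))"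
        using a(1) by simp
      then have "\<rho> y x < \<kappa> * R y"
        using a(2)[of y x z] by (simp add: \<kappa>_def algebra_simps)
      then show ?thesis
        using y by (auto simp: G_def qball_def)
    qed
    moreover have "emeasure M G \<le> ennreal (C / t) * (\<integral>\<^sup>+y. h y \<partial>M)"
      unfolding G_def
    proof (rule emeasure_UN_countable_le[OF cD])
      fix F assume F: "finite F" "F \<subseteq> D"
      have "emeasure M (\<Union>x\<in>F. qball \<rho> x (\<kappa> * R x)) \<le> (\<Sum>x\<in>F. emeasure M (qball \<rho> x (\<kappa> * R x)))"
        using F by (intro emeasure_subadditive_finite) auto
      \<comment> \<open>Each selected ball has measure below its integral of \<open>h\<close>
        divided by \<open>t\<close>. Read as the measure \<open>density M h\<close>, these integrals
        add up over the disjoint balls to at most the total integral.\<close>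
      also have "\<dots> \<le> (\<Sum>x\<in>F. ennreal (C / t) * emeasure (density M h) (qball \<rho> x (R x)))"
      proof (intro sum_mono)
        fix x assume "x \<in> F"
        then have x: "x \<in> E"
          using F D by auto
        have "emeasure M (qball \<rho> x (\<kappa> * R x)) = ennreal (measure M (qball \<rho> x (\<kappa> * R x)))"
          by (simp add: emeasure_eq_measure)
        also have "\<dots> \<le> ennreal (C / t * (t * measure M (qball \<rho> x (R x))))"
          using C(2)[OF Rpos[OF x], of x] t by (intro ennreal_leI) simp
        also have "\<dots> = ennreal (C / t) * ennreal (t * measure M (qball \<rho> x (R x)))"
          using C(1) t by (intro ennreal_mult) auto
        also have "\<dots> \<le> ennreal (C / t) * (\<integral>\<^sup>+y\<in>qball \<rho> x (R x). h y \<partial>M)"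
          using R(2)[OF x] by (intro mult_left_mono) (auto simp: P_def)
        finally show "emeasure M (qball \<rho> x (\<kappa> * R x)) \<le>
            ennreal (C / t) * emeasure (density M h) (qball \<rho> x (R x))"
          by (simp add: emeasure_density)
      qed
      also have "\<dots> = ennreal (C / t) * emeasure (density M h) (\<Union>x\<in>F. qball \<rho> x (R x))"
        unfolding sum_distrib_left[symmetric] using F D(2)
        by (subst sum_emeasure) (auto intro: disjoint_family_on_mono)
      also have "\<dots> \<le> ennreal (C / t) * emeasure (density M h) (space (density M h))"
        by (intro mult_left_mono emeasure_space) auto
      also have "emeasure (density M h) (space (density M h)) = (\<integral>\<^sup>+y. h y \<partial>M)"
        using sets.top[of M] by (subst emeasure_density) (auto simp: space_UNIV)
      finally show "emeasure M (\<Union>x\<in>F. qball \<rho> x (\<kappa> * R x)) \<le>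
          ennreal (C / t) * (\<integral>\<^sup>+y. h y \<partial>M)" .
    qed auto
    ultimately show ?thesis by blast
  qed
  then show ?thesis
    using C(1) by blast
qed

lemma nn_integral_qball_const: "0 \<le> c \<Longrightarrow> (\<integral>\<^sup>+y\<in>qball \<rho> x r. ennreal c \<partial>M) = ennreal (c * measure M (qball \<rho> x r))"
  by (simp add: nn_integral_cmult_indicator emeasure_eq_measure ennreal_mult)

text \<open>The strong \<open>(s, s)\<close> bound by Marcinkiewicz interpolation over dyadic
  levels. \<open>\<Phi>\<close> stands for the \<open>s\<close>-th power of the maximal function
  above the level \<open>L\<close>; the implication about averages expresses this without a possibly
  nonmeasurable supremum. The positive \<open>L\<close> gives the dyadic levels a starting
  point.\<close>

lemma maximal_majorant:
  fixes p s0 :: real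
  assumes "1 < s0"
  shows "\<exists>K\<ge>1. \<forall>f\<in>borel_measurable M. \<forall>s L. (\<forall>x. 0 \<le> f x) \<longrightarrow> s0 \<le> s \<longrightarrow> s \<le> p \<longrightarrow> 0 < L \<longrightarrow>
    (\<exists>\<Phi>\<in>borel_measurable M.
      (\<forall>x r u. 0 < r \<longrightarrow> L \<le> u \<longrightarrow> \<Phi> x \<le> ennreal (u powr s) \<longrightarrow>
         (\<integral>\<^sup>+y\<in>qball \<rho> x r. ennreal (f y) \<partial>M) \<le> ennreal (u * measure M (qball \<rho> x r))) \<and>
      (\<integral>\<^sup>+x. \<Phi> x \<partial>M) \<le> ennreal K * (\<integral>\<^sup>+x. ennreal (f x powr s) \<partial>M))"
proof -
  obtain C where C: "1 \<le> C" and weak: "\<And>h t. h \<in> borel_measurable M \<Longrightarrow> 0 < t \<Longrightarrow> \<exists>G\<in>sets M.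
     (\<forall>x r. 0 < r \<longrightarrow> ennreal (t * measure M (qball \<rho> x r)) < (\<integral>\<^sup>+y\<in>qball \<rho> x r. h y \<partial>M) \<longrightarrow> x \<in> G) \<and>
     emeasure M G \<le> ennreal (C / t) * (\<integral>\<^sup>+y. h y \<partial>M)"
    using weak_type_maximal by blast
  \<comment> \<open>\<open>4 powr s\<close> is largest at \<open>s = p\<close> and the geometric
    ratio \<open>2 powr - (s - 1)\<close> is largest at \<open>s = s0\<close>, so this constant
    serves all \<open>s\<close> in between.\<close>
  define K where "K = max 1 (4 powr p * C / (1 - 2 powr - (s0 - 1)))"
  have "\<exists>\<Phi>\<in>borel_measurable M.
      (\<forall>x r u. 0 < r \<longrightarrow> L \<le> u \<longrightarrow> \<Phi> x \<le> ennreal (u powr s) \<longrightarrow>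
         (\<integral>\<^sup>+y\<in>qball \<rho> x r. ennreal (f y) \<partial>M) \<le> ennreal (u * measure M (qball \<rho> x r))) \<and>
      (\<integral>\<^sup>+x. \<Phi> x \<partial>M) \<le> ennreal K * (\<integral>\<^sup>+x. ennreal (f x powr s) \<partial>M)"
    if f[measurable]: "f \<in> borel_measurable M" and f0: "\<And>x. 0 \<le> f x"
      and s: "s0 \<le> s" "s \<le> p" and L: "0 < L" for f s L
  proof -
    \<comment> \<open>Dyadic levels from \<open>L / 2\<close> on, so that every
      \<open>u \<ge> L\<close> satisfies \<open>2 * t k \<le> u < 4 * t k\<close> for some
      \<open>k\<close>. The truncation \<open>h k\<close> satisfies
      \<open>f \<le> h k + t k\<close>, hence an average of \<open>f\<close> above
      \<open>2 * t k\<close> forces an average of \<open>h k\<close> above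
      \<open>t k\<close>.\<close>
    define t where "t k = L / 2 * 2 ^ k" for k :: nat
    have t: "0 < t k" for k
      using L by (simp add: t_def)
    define h where "h k y = (if t k < f y then f y else 0)" for k y
    have h[measurable]: "h k \<in> borel_measurable M" for k
      unfolding h_def by measurable
    have h0: "0 \<le> h k y" for k y
      using f0 by (simp add: h_def)
    have "\<exists>G\<in>sets M. (\<forall>x r. 0 < r \<longrightarrow>
          ennreal (t k * measure M (qball \<rho> x r)) < (\<integral>\<^sup>+y\<in>qball \<rho> x r. ennreal (h k y) \<partial>M) \<longrightarrow> x \<in> G) \<and>
        emeasure M G \<le> ennreal (C / t k) * (\<integral>\<^sup>+y. ennreal (h k y) \<partial>M)" for k
      by (rule weak[OF _ t]) measurable
    then obtain G where G[measurable]: "\<And>k. G k \<in> sets M"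
      and GI: "\<And>k x r. 0 < r \<Longrightarrow>
          ennreal (t k * measure M (qball \<rho> x r)) < (\<integral>\<^sup>+y\<in>qball \<rho> x r. ennreal (h k y) \<partial>M) \<Longrightarrow> x \<in> G k"
      and Gle: "\<And>k. emeasure M (G k) \<le> ennreal (C / t k) * (\<integral>\<^sup>+y. ennreal (h k y) \<partial>M)"
      by metis
    \<comment> \<open>The weight is chosen so that membership in \<open>G k\<close> gives
      \<open>\<Phi> x \<ge> (4 * t k) powr s > u powr s\<close>, which is the contrapositive of the
      wanted implication.\<close>
    define \<Phi> where "\<Phi> x = (\<Sum>k. ennreal ((4 * t k) powr s) * indicator (G k) x)" for x
    have \<Phi>_meas: "\<Phi> \<in> borel_measurable M"
      unfolding \<Phi>_def by measurable
    have avg: "(\<integral>\<^sup>+y\<in>qball \<rho> x r. ennreal (f y) \<partial>M) \<le> ennreal (u * measure M (qball \<rho> x r))"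
      if r: "0 < r" and u: "L \<le> u" and \<Phi>u: "\<Phi> x \<le> ennreal (u powr s)" for x r u
    proof (rule ccontr)
      let ?B = "qball \<rho> x r"
      assume no: "\<not> ?thesis"
      obtain k where "2 ^ k \<le> u / L" "u / L < 2 ^ Suc k"
        using ex_dyadic_scale[of "u / L"] u L by auto
      then have k: "2 * t k \<le> u" "u < 4 * t k"
        using L by (auto simp: t_def field_simps)
      have "ennreal (t k * measure M ?B) < (\<integral>\<^sup>+y\<in>?B. ennreal (h k y) \<partial>M)"
      proof (rule ccontr)
        assume "\<not> ?thesis"
        then have le: "(\<integral>\<^sup>+y\<in>?B. ennreal (h k y) \<partial>M) \<le> ennreal (t k * measure M ?B)" by simp
        have "(\<integral>\<^sup>+y\<in>?B. ennreal (f y) \<partial>M) \<le> (\<integral>\<^sup>+y. ennreal (h k y) * indicator ?B y + ennreal (t k) * indicator ?B y \<partial>M)"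
        proof (rule nn_integral_mono)
          fix y
          have "ennreal (f y) \<le> ennreal (h k y) + ennreal (t k)"
            using t[of k] f0[of y] by (subst ennreal_plus[symmetric]) (auto simp: h_def intro!: ennreal_leI)
          then show "ennreal (f y) * indicator ?B y \<le> ennreal (h k y) * indicator ?B y + ennreal (t k) * indicator ?B y"
            by (simp add: distrib_right[symmetric] mult_right_mono)
        qed
        also have "\<dots> = (\<integral>\<^sup>+y\<in>?B. ennreal (h k y) \<partial>M) + (\<integral>\<^sup>+y\<in>?B. ennreal (t k) \<partial>M)"
          by (rule nn_integral_add) measurable
        also have "(\<integral>\<^sup>+y\<in>?B. ennreal (t k) \<partial>M) = ennreal (t k * measure M ?B)"
          using t[of k] by (intro nn_integral_qball_const) simp
        also have "(\<integral>\<^sup>+y\<in>?B. ennreal (h k y) \<partial>M) + ennreal (t k * measure M ?B) \<le>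
            ennreal (t k * measure M ?B) + ennreal (t k * measure M ?B)"
          using le by (rule add_right_mono)
        also have "\<dots> = ennreal (2 * t k * measure M ?B)"
          using t[of k] by (subst ennreal_plus[symmetric]) auto
        also have "\<dots> \<le> ennreal (u * measure M ?B)"
          using k by (intro ennreal_leI mult_right_mono) auto
        finally show False using no by simp
      qed
      then have "x \<in> G k" by (rule GI[OF r])
      then have "ennreal ((4 * t k) powr s) \<le> \<Phi> x"
        using le_suminf_ennreal[of "\<lambda>k. ennreal ((4 * t k) powr s) * indicator (G k) x" k]
        by (simp add: \<Phi>_def)
      also note \<Phi>u
      finally have "(4 * t k) powr s \<le> u powr s"
        by simp
      moreover have "u powr s < (4 * t k) powr s"
        using k u L s assms by (intro powr_less_mono2) auto
      ultimately show False by simp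
    qed
    have "(\<integral>\<^sup>+x. \<Phi> x \<partial>M) = (\<Sum>k. \<integral>\<^sup>+x. ennreal ((4 * t k) powr s) * indicator (G k) x \<partial>M)"
      unfolding \<Phi>_def by (rule nn_integral_suminf) measurable
    also have "\<dots> \<le> (\<Sum>k. \<integral>\<^sup>+y. ennreal (4 powr s * C * (t k powr (s - 1) * h k y)) \<partial>M)"
    proof (intro suminf_le allI)
      fix k
      have "(\<integral>\<^sup>+x. ennreal ((4 * t k) powr s) * indicator (G k) x \<partial>M) =
          ennreal ((4 * t k) powr s) * emeasure M (G k)"
        by (simp add: nn_integral_cmult_indicator)
      also have "\<dots> \<le> ennreal ((4 * t k) powr s) * (ennreal (C / t k) * (\<integral>\<^sup>+y. ennreal (h k y) \<partial>M))"
        by (intro mult_left_mono Gle) auto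
      also have "\<dots> = ennreal ((4 * t k) powr s * (C / t k)) * (\<integral>\<^sup>+y. ennreal (h k y) \<partial>M)"
        using C t[of k] by (subst ennreal_mult) (auto simp: mult.assoc)
      also have "(4 * t k) powr s * (C / t k) = 4 powr s * C * t k powr (s - 1)"
        using t[of k] by (simp add: powr_mult powr_diff)
      also have "ennreal \<dots> * (\<integral>\<^sup>+y. ennreal (h k y) \<partial>M) =
          (\<integral>\<^sup>+y. ennreal (4 powr s * C * t k powr (s - 1)) * ennreal (h k y) \<partial>M)"
        by (rule nn_integral_cmult[symmetric]) measurable
      also have "\<dots> = (\<integral>\<^sup>+y. ennreal (4 powr s * C * (t k powr (s - 1) * h k y)) \<partial>M)"
        using C h0 by (intro nn_integral_cong) (simp add: ennreal_mult'[symmetric] mult.assoc)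
      finally show "(\<integral>\<^sup>+x. ennreal ((4 * t k) powr s) * indicator (G k) x \<partial>M) \<le>
          (\<integral>\<^sup>+y. ennreal (4 powr s * C * (t k powr (s - 1) * h k y)) \<partial>M)" by simp
    qed auto
    also have "\<dots> = (\<integral>\<^sup>+y. (\<Sum>k. ennreal (4 powr s * C * (t k powr (s - 1) * h k y))) \<partial>M)"
      by (rule nn_integral_suminf[symmetric]) measurable
    \<comment> \<open>For fixed \<open>y\<close> only the levels \<open>t k < f y\<close> count, and
      the sum of \<open>t k powr (s - 1)\<close> over them is at most a constant times
      \<open>f y powr (s - 1)\<close>.\<close>
    also have "\<dots> \<le> (\<integral>\<^sup>+y. ennreal K * ennreal (f y powr s) \<partial>M)"
    proof (intro nn_integral_mono suminf_ennreal_le)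
      fix y n
      have "(\<Sum>k<n. ennreal (4 powr s * C * (t k powr (s - 1) * h k y))) =
          ennreal (\<Sum>k<n. 4 powr s * C * (t k powr (s - 1) * h k y))"
        using C h0 by (intro sum_ennreal) auto
      also have "(\<Sum>k<n. 4 powr s * C * (t k powr (s - 1) * h k y)) =
          4 powr s * C * f y * (\<Sum>k<n. if L / 2 * 2 ^ k < f y then (L / 2 * 2 ^ k) powr (s - 1) else 0)"
        unfolding sum_distrib_left by (intro sum.cong) (auto simp: h_def t_def)
      also have "\<dots> \<le> 4 powr s * C * f y * (f y powr (s - 1) / (1 - 2 powr - (s - 1)))"
        using s assms L C f0[of y] by (intro mult_left_mono dyadic_powr_sum_le) auto
      also have "\<dots> = 4 powr s * C / (1 - 2 powr - (s - 1)) * f y powr s"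
        using powr_add[of "f y" 1 "s - 1"] f0[of y] by (cases "f y = 0") (auto simp: field_simps)
      also have "\<dots> \<le> K * f y powr s"
      proof (intro mult_right_mono)
        have "2 powr - (s - 1) \<le> 2 powr - (s0 - 1)" "(2::real) powr - (s0 - 1) < 1"
          using s assms by (auto simp: powr_less_one)
        moreover have "4 powr s \<le> 4 powr p"
          using s by simp
        ultimately have "4 powr s * C / (1 - 2 powr - (s - 1)) \<le> 4 powr p * C / (1 - 2 powr - (s0 - 1))"
          using C by (intro frac_le mult_right_mono) auto
        then show "4 powr s * C / (1 - 2 powr - (s - 1)) \<le> K"
          by (simp add: K_def)
      qed simp
      also have "ennreal (K * f y powr s) = ennreal K * ennreal (f y powr s)"
        by (rule ennreal_mult) (auto simp: K_def)
      finally show "(\<Sum>k<n. ennreal (4 powr s * C * (t k powr (s - 1) * h k y))) \<le>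
          ennreal K * ennreal (f y powr s)"
        by (simp add: ennreal_leI)
    qed
    also have "\<dots> = ennreal K * (\<integral>\<^sup>+x. ennreal (f x powr s) \<partial>M)"
      by (rule nn_integral_cmult) measurable
    finally show ?thesis
      using \<Phi>_meas avg by blast
  qed
  moreover have "1 \<le> K" by (simp add: K_def)
  ultimately show ?thesis by blast
qed

section \<open>Morrey bounds and the maximal function on Morrey spaces\<close>

text \<open>For nonnegative \<open>f\<close>, \<open>N\<close> bounds the classical Morrey norm. All
  positive radii are allowed, also those beyond the diameter, so that balls can be enlarged
  freely.\<close>

definition morrey_bound :: "real \<Rightarrow> real \<Rightarrow> real \<Rightarrow> ('a \<Rightarrow> real) \<Rightarrow> bool" where
  "morrey_bound s lam N f \<longleftrightarrow> (\<forall>x r. 0 < r \<longrightarrow>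
     (\<integral>\<^sup>+y\<in>qball \<rho> x r. ennreal (f y powr s) \<partial>M) \<le> ennreal (N powr s * measure M (qball \<rho> x r) powr lam))"

text \<open>Integrated form of \<open>powr_le_split\<close>. Monotonicity passes from the possibly
  nonmeasurable integrand to one built from the measurable \<open>H\<close>; additivity is used only
  afterwards.\<close>

lemma nn_integral_powr_le_split:
  assumes [measurable]: "H \<in> borel_measurable M" "A \<in> sets M"
    and K: "0 < K" and ab: "0 \<le> a" "a \<le> b"
    and f: "\<And>y. y \<in> A \<Longrightarrow> 0 \<le> f y" "\<And>y. y \<in> A \<Longrightarrow> ennreal (f y powr b) \<le> H y"
  shows "(\<integral>\<^sup>+y\<in>A. ennreal (f y powr a) \<partial>M) \<le>
    ennreal (K powr a * measure M A) + ennreal (K powr (a - b)) * (\<integral>\<^sup>+y\<in>A. H y \<partial>M)"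
proof -
  have "(\<integral>\<^sup>+y\<in>A. ennreal (f y powr a) \<partial>M) \<le>
      (\<integral>\<^sup>+y. ennreal (K powr a) * indicator A y + ennreal (K powr (a - b)) * (H y * indicator A y) \<partial>M)"
  proof (rule nn_integral_mono)
    fix y
    show "ennreal (f y powr a) * indicator A y \<le>
        ennreal (K powr a) * indicator A y + ennreal (K powr (a - b)) * (H y * indicator A y)"
    proof (cases "y \<in> A")
      case True
      have "ennreal (f y powr a) \<le> ennreal (K powr a + f y powr b * K powr (a - b))"
        using f(1)[OF True] K ab by (intro ennreal_leI powr_le_split)
      also have "\<dots> = ennreal (K powr a) + ennreal (K powr (a - b)) * ennreal (f y powr b)"
        by (simp add: ennreal_mult' mult.commute)
      also have "\<dots> \<le> ennreal (K powr a) + ennreal (K powr (a - b)) * H y"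
        by (intro add_left_mono mult_left_mono f(2) True) simp
      finally show ?thesis using True by simp
    qed simp
  qed
  also have "\<dots> = ennreal (K powr a) * emeasure M A + ennreal (K powr (a - b)) * (\<integral>\<^sup>+y\<in>A. H y \<partial>M)"
    by (simp add: nn_integral_add nn_integral_cmult nn_integral_cmult_indicator)
  finally show ?thesis
    by (simp add: emeasure_eq_measure ennreal_mult)
qed

text \<open>
  A substitute for Hoelder's inequality that loses only a factor of two and also applies to
  lower integrals of non-measurable functions with a measurable majorant.
\<close>

lemma morrey_holder:
  assumes [measurable]: "H \<in> borel_measurable M"
    and r: "0 < r" and N: "0 < N" and ab: "0 \<le> a" "a \<le> b" "0 < b"
    and f: "\<And>y. y \<in> qball \<rho> x r \<Longrightarrow> 0 \<le> f y" "\<And>y. y \<in> qball \<rho> x r \<Longrightarrow> ennreal (f y powr b) \<le> H y"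
    and H: "(\<integral>\<^sup>+y\<in>qball \<rho> x r. H y \<partial>M) \<le> ennreal (N powr b * measure M (qball \<rho> x r) powr lam)"
  shows "(\<integral>\<^sup>+y\<in>qball \<rho> x r. ennreal (f y powr a) \<partial>M) \<le>
    ennreal (2 * N powr a * measure M (qball \<rho> x r) powr (1 - (1 - lam) * a / b))"
proof -
  define V where "V = measure M (qball \<rho> x r)"
  have V: "0 < V"
    unfolding V_def using r by (rule measure_qball_pos)
  \<comment> \<open>The threshold at which the two terms agree:
    \<open>K powr b = N powr b * V powr (lam - 1)\<close>. Their equality is the source of the
    factor 2.\<close>
  define K where "K = N * V powr ((lam - 1) / b)"
  have K: "0 < K"
    using N V by (simp add: K_def)
  have "(\<integral>\<^sup>+y\<in>qball \<rho> x r. ennreal (f y powr a) \<partial>M) \<le>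
      ennreal (K powr a * V) + ennreal (K powr (a - b)) * (\<integral>\<^sup>+y\<in>qball \<rho> x r. H y \<partial>M)"
    unfolding V_def using K ab f by (intro nn_integral_powr_le_split) auto
  also have "\<dots> \<le> ennreal (K powr a * V) + ennreal (K powr (a - b)) * ennreal (N powr b * V powr lam)"
    using H unfolding V_def by (intro add_left_mono mult_left_mono) auto
  also have "\<dots> = ennreal (K powr a * V + K powr (a - b) * (N powr b * V powr lam))"
    using V by (simp add: ennreal_mult')
  also have "K powr a * V = N powr a * V powr (1 - (1 - lam) * a / b)"
  proof -
    have "K powr a = N powr a * V powr ((lam - 1) / b * a)"
      using N V by (simp add: K_def powr_mult powr_powr)
    moreover have "V powr ((lam - 1) / b * a) * V = V powr ((lam - 1) / b * a + 1)"
      using V by (simp add: powr_add)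
    moreover have "(lam - 1) / b * a + 1 = 1 - (1 - lam) * a / b"
      using ab by (simp add: field_simps)
    ultimately show ?thesis by simp
  qed
  also have "K powr (a - b) * (N powr b * V powr lam) = N powr a * V powr (1 - (1 - lam) * a / b)"
  proof -
    have "K powr (a - b) = N powr (a - b) * V powr ((lam - 1) / b * (a - b))"
      using N V by (simp add: K_def powr_mult powr_powr)
    then have "K powr (a - b) * (N powr b * V powr lam) =
        (N powr (a - b) * N powr b) * (V powr ((lam - 1) / b * (a - b)) * V powr lam)"
      by (simp only: ac_simps)
    also have "\<dots> = N powr a * V powr ((lam - 1) / b * (a - b) + lam)"
      by (simp only: powr_add[symmetric]) simp
    also have "(lam - 1) / b * (a - b) + lam = 1 - (1 - lam) * a / b"
      using ab by (simp add: field_simps)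
    finally show ?thesis .
  qed
  finally show ?thesis by (simp add: V_def mult.assoc)
qed

lemma morrey_bound_L1:
  assumes [measurable]: "f \<in> borel_measurable M" and f0: "\<And>x. 0 \<le> f x"
    and "morrey_bound s lam N f" "0 < N" "1 \<le> s" "0 < r"
  shows "(\<integral>\<^sup>+y\<in>qball \<rho> x r. ennreal (f y) \<partial>M) \<le>
    ennreal (2 * N * measure M (qball \<rho> x r) powr (1 - (1 - lam) / s))"
  using morrey_holder[of "\<lambda>y. ennreal (f y powr s)" r N 1 s x f lam] assms
  by (simp add: morrey_bound_def)

text \<open>Averages over balls of radius below \<open>r0\<close> centred in
  \<open>B(x0, r0)\<close> see only the restriction of \<open>f\<close> to an enlarged ball, to
  which \<open>maximal_majorant\<close> applies. Averages over larger balls are bounded by a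
  constant through the Morrey bound itself. Localising is the reason why \<open>\<Phi>\<close>
  depends on the ball.\<close>

lemma maximal_morrey:
  fixes p s0 lam :: real
  assumes s0: "1 < s0" and lam: "0 \<le> lam" "lam < 1"
  obtains K where "1 \<le> K"
    and "\<And>f s N x0 r0. f \<in> borel_measurable M \<Longrightarrow> (\<And>x. 0 \<le> f x) \<Longrightarrow> s0 \<le> s \<Longrightarrow> s \<le> p \<Longrightarrow> 0 < N \<Longrightarrow>
      morrey_bound s lam N f \<Longrightarrow> 0 < r0 \<Longrightarrow> \<exists>\<Phi>\<in>borel_measurable M. (\<forall>x. 0 < \<Phi> x) \<and>
        (\<forall>x\<in>qball \<rho> x0 r0. \<forall>r u. 0 < r \<longrightarrow> 0 < u \<longrightarrow> \<Phi> x \<le> ennreal (u powr s) \<longrightarrow>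
           (\<integral>\<^sup>+y\<in>qball \<rho> x r. ennreal (f y) \<partial>M) \<le> ennreal (u * measure M (qball \<rho> x r))) \<and>
        (\<integral>\<^sup>+x\<in>qball \<rho> x0 r0. \<Phi> x \<partial>M) \<le> ennreal (K * N powr s * measure M (qball \<rho> x0 r0) powr lam)"
proof -
  obtain K1 where K1: "1 \<le> K1" and maj: "\<And>f s L. f \<in> borel_measurable M \<Longrightarrow> (\<And>x. 0 \<le> f x) \<Longrightarrow>
      s0 \<le> s \<Longrightarrow> s \<le> p \<Longrightarrow> 0 < L \<Longrightarrow> \<exists>\<Phi>\<in>borel_measurable M.
      (\<forall>x r u. 0 < r \<longrightarrow> L \<le> u \<longrightarrow> \<Phi> x \<le> ennreal (u powr s) \<longrightarrow>
         (\<integral>\<^sup>+y\<in>qball \<rho> x r. ennreal (f y) \<partial>M) \<le> ennreal (u * measure M (qball \<rho> x r))) \<and>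
      (\<integral>\<^sup>+x. \<Phi> x \<partial>M) \<le> ennreal K1 * (\<integral>\<^sup>+x. ennreal (f x powr s) \<partial>M)"
    using maximal_majorant[OF s0, of p] by blast
  obtain a where a: "1 \<le> a" "\<And>x y z. \<rho> x y \<le> a * (\<rho> x z + \<rho> z y)" "\<And>x y. \<rho> x y \<le> a * \<rho> y x"
    using quasi_metric_constant by blast
  obtain c1 where c1: "1 \<le> c1" "\<And>x r. 0 < r \<Longrightarrow>
      measure M (qball \<rho> x (2 * a * r)) \<le> c1 * measure M (qball \<rho> x r)"
    using dilation[of "2 * a"] by blast
  obtain c2 where c2: "1 \<le> c2" "\<And>x r. 0 < r \<Longrightarrow>
      measure M (qball \<rho> x (a * (a + 1) * r)) \<le> c2 * measure M (qball \<rho> x r)"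
    using dilation[of "a * (a + 1)"] by blast
  define K where "K = (2 * c2) powr p + K1 * c1"
  have main: "\<exists>\<Phi>\<in>borel_measurable M. (\<forall>x. 0 < \<Phi> x) \<and>
      (\<forall>x\<in>qball \<rho> x0 r0. \<forall>r u. 0 < r \<longrightarrow> 0 < u \<longrightarrow> \<Phi> x \<le> ennreal (u powr s) \<longrightarrow>
         (\<integral>\<^sup>+y\<in>qball \<rho> x r. ennreal (f y) \<partial>M) \<le> ennreal (u * measure M (qball \<rho> x r))) \<and>
      (\<integral>\<^sup>+x\<in>qball \<rho> x0 r0. \<Phi> x \<partial>M) \<le> ennreal (K * N powr s * measure M (qball \<rho> x0 r0) powr lam)"
    if f[measurable]: "f \<in> borel_measurable M" and f0: "\<And>x. 0 \<le> f x"
      and s: "s0 \<le> s" "s \<le> p" and N: "0 < N" and mb: "morrey_bound s lam N f" and r0: "0 < r0"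
    for f s N x0 r0
  proof -
    define V where "V = measure M (qball \<rho> x0 r0)"
    have V: "0 < V"
      unfolding V_def using r0 by (rule measure_qball_pos)
    define \<gamma> where "\<gamma> = (1 - lam) / s"
    have \<gamma>: "0 \<le> \<gamma>" "\<gamma> \<le> 1"
      using s s0 lam by (auto simp: \<gamma>_def)
    \<comment> \<open>An upper bound for the averages of \<open>f\<close> over balls of radius at
      least \<open>r0\<close> centred in \<open>B(x0, r0)\<close>: each is at most
      \<open>2 * N * W powr - \<gamma>\<close> with \<open>W \<ge> V / c2\<close> the measure of the
      ball.\<close>
    define L where "L = 2 * N * c2 * V powr - \<gamma>"
    have L: "0 < L"
      using N c2 V by (simp add: L_def)
    let ?A = "qball \<rho> x0 (2 * a * r0)"
    define g where "g y = f y * indicator ?A y" for y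
    have g[measurable]: "g \<in> borel_measurable M"
      unfolding g_def by measurable
    have g0: "0 \<le> g y" for y
      using f0 by (simp add: g_def)
    obtain \<Psi> where \<Psi>[measurable]: "\<Psi> \<in> borel_measurable M"
      and avg: "\<And>x r u. 0 < r \<Longrightarrow> L \<le> u \<Longrightarrow> \<Psi> x \<le> ennreal (u powr s) \<Longrightarrow>
         (\<integral>\<^sup>+y\<in>qball \<rho> x r. ennreal (g y) \<partial>M) \<le> ennreal (u * measure M (qball \<rho> x r))"
      and \<Psi>_int: "(\<integral>\<^sup>+x. \<Psi> x \<partial>M) \<le> ennreal K1 * (\<integral>\<^sup>+x. ennreal (g x powr s) \<partial>M)"
      using maj[OF g g0 s L] by blast
    \<comment> \<open>The added constant makes \<open>\<Phi>\<close> positive and turns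
      \<open>\<Phi> x \<le> u powr s\<close> into \<open>L \<le> u\<close>, which both ranges of
      radii use.\<close>
    define \<Phi> where "\<Phi> x = ennreal (L powr s) + \<Psi> x" for x
    have "\<Phi> \<in> borel_measurable M"
      unfolding \<Phi>_def by measurable
    moreover have "0 < \<Phi> x" for x
      using L by (simp add: \<Phi>_def add_pos_nonneg)
    moreover have "(\<integral>\<^sup>+y\<in>qball \<rho> x r. ennreal (f y) \<partial>M) \<le> ennreal (u * measure M (qball \<rho> x r))"
      if x: "x \<in> qball \<rho> x0 r0" and r: "0 < r" and u: "0 < u" and \<Phi>u: "\<Phi> x \<le> ennreal (u powr s)" for x r u
    proof -
      have "ennreal (L powr s) \<le> ennreal (u powr s)" "\<Psi> x \<le> ennreal (u powr s)"
        using order_trans[OF _ \<Phi>u] by (simp_all add: \<Phi>_def)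
      then have "L powr s \<le> u powr s" and \<Psi>u: "\<Psi> x \<le> ennreal (u powr s)" by auto
      then have Lu: "L \<le> u"
        using powr_less_mono2[of s u L] u s s0 by (meson less_imp_le linorder_not_less order.strict_trans2 zero_less_one)
      show ?thesis
      proof (cases "r < r0")
        case True
        have "qball \<rho> x r \<subseteq> ?A"
        proof
          fix y assume y: "y \<in> qball \<rho> x r"
          have "\<rho> x0 y \<le> a * (\<rho> x0 x + \<rho> x y)" by (rule a)
          also have "\<dots> < a * (r0 + r0)"
            using x y a(1) True by (intro mult_strict_left_mono) (auto simp: qball_def)
          finally show "y \<in> ?A" by (simp add: qball_def)
        qed
        then have "(\<integral>\<^sup>+y\<in>qball \<rho> x r. ennreal (f y) \<partial>M) = (\<integral>\<^sup>+y\<in>qball \<rho> x r. ennreal (g y) \<partial>M)"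
          by (intro nn_integral_cong) (auto simp: g_def indicator_def)
        also have "\<dots> \<le> ennreal (u * measure M (qball \<rho> x r))"
          using r Lu \<Psi>u by (rule avg)
        finally show ?thesis .
      next
        \<comment> \<open>Large radii: the enlarged \<open>B(x, r)\<close> contains
          \<open>B(x0, r0)\<close>, so its measure is not much smaller than \<open>V\<close>, and
          the average is at most \<open>L\<close>.\<close>
        case False
        define W where "W = measure M (qball \<rho> x r)"
        have W: "0 < W"
          unfolding W_def using r by (rule measure_qball_pos)
        have "qball \<rho> x0 r0 \<subseteq> qball \<rho> x (a * (a + 1) * r)"
        proof
          fix y assume y: "y \<in> qball \<rho> x0 r0"
          have "\<rho> x x0 \<le> a * \<rho> x0 x" by (rule a)
          also have "\<dots> \<le> a * r0"
            using x a(1) by (intro mult_left_mono) (auto simp: qball_def)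
          finally have "\<rho> x x0 + \<rho> x0 y < (a + 1) * r0"
            using y by (simp add: qball_def algebra_simps)
          then have "a * (\<rho> x x0 + \<rho> x0 y) < a * ((a + 1) * r0)"
            using a(1) by simp
          also have "\<dots> \<le> a * ((a + 1) * r)"
            using False a(1) by (intro mult_left_mono) auto
          finally show "y \<in> qball \<rho> x (a * (a + 1) * r)"
            using a(2)[of x y x0] by (simp add: qball_def mult.assoc)
        qed
        then have "V \<le> measure M (qball \<rho> x (a * (a + 1) * r))"
          unfolding V_def by (intro finite_measure_mono) auto
        also have "\<dots> \<le> c2 * W"
          unfolding W_def using r by (rule c2)
        finally have "V / c2 \<le> W"
          using c2 by (simp add: field_simps)
        then have "W powr - \<gamma> \<le> (V / c2) powr - \<gamma>"
          using V c2 \<gamma> by (intro powr_mono2') auto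
        also have "\<dots> = c2 powr \<gamma> * V powr - \<gamma>"
          using V c2 by (simp add: powr_divide powr_minus field_simps)
        also have "\<dots> \<le> c2 * V powr - \<gamma>"
          using c2 \<gamma> powr_mono[of \<gamma> 1 c2] by (intro mult_right_mono) auto
        finally have W\<gamma>: "W powr - \<gamma> \<le> c2 * V powr - \<gamma>" .
        have "(\<integral>\<^sup>+y\<in>qball \<rho> x r. ennreal (f y) \<partial>M) \<le> ennreal (2 * N * W powr (1 - \<gamma>))"
          unfolding W_def \<gamma>_def using f0 mb N s s0 r by (intro morrey_bound_L1) auto
        also have "2 * N * W powr (1 - \<gamma>) = 2 * N * W powr - \<gamma> * W"
          using W by (simp add: powr_diff powr_minus field_simps)
        also have "ennreal \<dots> \<le> ennreal (u * W)"
        proof (intro ennreal_leI mult_right_mono)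
          have "2 * N * W powr - \<gamma> \<le> 2 * N * (c2 * V powr - \<gamma>)"
            using W\<gamma> N by (intro mult_left_mono) auto
          then show "2 * N * W powr - \<gamma> \<le> u"
            using Lu by (simp add: L_def mult.assoc)
        qed (use W in simp)
        finally show ?thesis by (simp add: W_def)
      qed
    qed
    moreover have "(\<integral>\<^sup>+x\<in>qball \<rho> x0 r0. \<Phi> x \<partial>M) \<le> ennreal (K * N powr s * V powr lam)"
    proof -
      have "(\<integral>\<^sup>+x\<in>qball \<rho> x0 r0. \<Phi> x \<partial>M) \<le>
          (\<integral>\<^sup>+x. ennreal (L powr s) * indicator (qball \<rho> x0 r0) x + \<Psi> x \<partial>M)"
        by (intro nn_integral_mono) (auto simp: \<Phi>_def indicator_def)
      also have "\<dots> = ennreal (L powr s * V) + (\<integral>\<^sup>+x. \<Psi> x \<partial>M)"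
        unfolding V_def by (simp add: nn_integral_add nn_integral_qball_const)
      also have "\<dots> \<le> ennreal (L powr s * V) + ennreal K1 * ennreal (c1 * (N powr s * V powr lam))"
      proof (intro add_left_mono order_trans[OF \<Psi>_int] mult_left_mono)
        have "(\<integral>\<^sup>+x. ennreal (g x powr s) \<partial>M) = (\<integral>\<^sup>+x\<in>?A. ennreal (f x powr s) \<partial>M)"
          using s s0 by (intro nn_integral_cong) (auto simp: g_def indicator_def)
        also have "\<dots> \<le> ennreal (N powr s * measure M ?A powr lam)"
          using mb a(1) r0 by (simp add: morrey_bound_def)
        also have "\<dots> \<le> ennreal (c1 * (N powr s * V powr lam))"
        proof (rule ennreal_leI)
          have "measure M ?A powr lam \<le> (c1 * V) powr lam"
            unfolding V_def using c1(2)[OF r0] lam by (intro powr_mono2) auto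
          also have "\<dots> = c1 powr lam * V powr lam"
            using c1 V by (simp add: powr_mult)
          also have "\<dots> \<le> c1 * V powr lam"
            using c1 lam powr_mono[of lam 1 c1] by (intro mult_right_mono) auto
          finally show "N powr s * measure M ?A powr lam \<le> c1 * (N powr s * V powr lam)"
            using mult_left_mono[of "measure M ?A powr lam" "c1 * V powr lam" "N powr s"]
            by (simp add: mult.left_commute)
        qed
        finally show "(\<integral>\<^sup>+x. ennreal (g x powr s) \<partial>M) \<le> ennreal (c1 * (N powr s * V powr lam))" .
      qed simp
      also have "\<dots> = ennreal (L powr s * V + K1 * (c1 * (N powr s * V powr lam)))"
        using K1 V c1 by (simp add: ennreal_mult')
      also have "\<dots> \<le> ennreal (K * N powr s * V powr lam)"
      proof (rule ennreal_leI)
        \<comment> \<open>The constant part of \<open>\<Phi>\<close> also has Morrey growth: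
          \<open>\<gamma> = (1 - lam) / s\<close> makes the total exponent of \<open>V\<close> equal
          to \<open>lam\<close>.\<close>
        have "L powr s * V = (2 * c2) powr s * N powr s * (V powr (- \<gamma> * s) * V)"
          using N c2 V by (simp add: L_def powr_mult powr_powr)
        also have "V powr (- \<gamma> * s) * V = V powr (- \<gamma> * s + 1)"
          using V by (subst powr_add) simp
        also have "- \<gamma> * s + 1 = lam"
          using s s0 by (simp add: \<gamma>_def)
        also have "(2 * c2) powr s * N powr s * V powr lam \<le> (2 * c2) powr p * N powr s * V powr lam"
          using s c2 by (intro mult_right_mono powr_mono) auto
        finally show "L powr s * V + K1 * (c1 * (N powr s * V powr lam)) \<le> K * N powr s * V powr lam"
          by (simp add: K_def algebra_simps)
      qed
      finally show ?thesis .
    qed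
    ultimately show ?thesis
      unfolding V_def by blast
  qed
  have K0: "1 \<le> K"
  proof -
    have "1 \<le> K1 * c1"
      using K1 c1 mult_mono[of 1 K1 1 c1] by simp
    then show ?thesis by (simp add: K_def add_increasing)
  qed
  show ?thesis
    by (rule that[OF K0]) (rule main; (assumption | simp))
qed

section \<open>The potential operator\<close>

lemma singleton_sets [measurable]: "{x} \<in> sets M"
proof -
  have "{y \<in> space M. \<rho> x y = 0} \<in> sets M" by measurable
  also have "{y \<in> space M. \<rho> x y = 0} = {x}"
    by (auto simp: space_UNIV rho_eq_0_iff)
  finally show ?thesis .
qed

text \<open>The kernel is summed over dyadic levels of \<open>\<mu>(B(x, \<rho>(x, y)))\<close>.
  Below the level \<open>\<tau>\<close> the bound \<open>u\<close> on averages gives a series with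
  ratio \<open>2 powr - \<alpha>\<close>; above it the Morrey bound gives one with ratio
  \<open>2 powr - \<gamma>\<close>. The number \<open>u\<close> replaces the value of the maximal
  function at \<open>x\<close>.\<close>

lemma hedberg:
  fixes \<alpha> lam q :: real
  assumes \<alpha>: "0 < \<alpha>" "\<alpha> < 1" and lam: "0 \<le> lam" "lam < 1" and q: "0 < q"
  obtains C where "1 \<le> C"
    and "\<And>f x s t N u. f \<in> borel_measurable M \<Longrightarrow> (\<And>y. 0 \<le> f y) \<Longrightarrow> 1 \<le> s \<Longrightarrow> 0 < t \<Longrightarrow> t \<le> q \<Longrightarrow>
      1 / s - 1 / t = \<alpha> / (1 - lam) \<Longrightarrow> 0 < N \<Longrightarrow> 0 < u \<Longrightarrow> morrey_bound s lam N f \<Longrightarrow>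
      (\<And>r. 0 < r \<Longrightarrow> (\<integral>\<^sup>+y\<in>qball \<rho> x r. ennreal (f y) \<partial>M) \<le> ennreal (u * measure M (qball \<rho> x r))) \<Longrightarrow>
      (\<integral>\<^sup>+y. ennreal (f y / measure M (qball \<rho> x (\<rho> x y)) powr (1 - \<alpha>)) \<partial>M) \<le>
        ennreal (C * (N powr (1 - s / t) * u powr (s / t)))"
proof -
  obtain c where c: "1 \<le> c" and sublevel: "\<And>x \<sigma>. {y. measure M (qball \<rho> x (\<rho> x y)) \<le> \<sigma>} \<subseteq> {x} \<or>
     (\<exists>r>0. {y. measure M (qball \<rho> x (\<rho> x y)) \<le> \<sigma>} \<subseteq> qball \<rho> x r \<and>
            measure M (qball \<rho> x r) \<le> c * \<sigma>)"
    using sublevel_subset_qball by blast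
  define C1 where "C1 = 2 * c / (1 - 2 powr - \<alpha>)"
  \<comment> \<open>Since \<open>t \<le> q\<close>, the exponent
    \<open>\<gamma> = (1 - lam) / t\<close> of the far series is at least
    \<open>(1 - lam) / q\<close>, which makes the constant uniform in \<open>t\<close>.\<close>
  define C2 where "C2 = 4 * c / (1 - 2 powr - ((1 - lam) / q))"
  have small: "2 powr - \<alpha> < 1" "2 powr - ((1 - lam) / q) < 1"
    using \<alpha> lam q by (auto simp: powr_less_one)
  have C1: "1 \<le> C1"
    using c small add_increasing2[of "2 powr - \<alpha>" 1 "2 * c"] by (simp add: C1_def le_divide_eq)
  have C2: "0 \<le> C2"
    using c small by (simp add: C2_def)
  have main: "(\<integral>\<^sup>+y. ennreal (f y / measure M (qball \<rho> x (\<rho> x y)) powr (1 - \<alpha>)) \<partial>M) \<le>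
      ennreal ((C1 + C2) * (N powr (1 - s / t) * u powr (s / t)))"
    if f[measurable]: "f \<in> borel_measurable M" and f0: "\<And>y. 0 \<le> f y"
      and s: "1 \<le> s" and t: "0 < t" "t \<le> q" and st: "1 / s - 1 / t = \<alpha> / (1 - lam)"
      and N: "0 < N" and u: "0 < u" and mb: "morrey_bound s lam N f"
      and avg: "\<And>r. 0 < r \<Longrightarrow>
        (\<integral>\<^sup>+y\<in>qball \<rho> x r. ennreal (f y) \<partial>M) \<le> ennreal (u * measure M (qball \<rho> x r))"
    for f x s t N u
  proof -
    define v where "v y = measure M (qball \<rho> x (\<rho> x y))" for y
    have v[measurable]: "v \<in> borel_measurable M"
      unfolding v_def by measurable
    define F where "F \<sigma> = {y. v y \<le> \<sigma>}" for \<sigma>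
    have F[measurable]: "F \<sigma> \<in> sets M" for \<sigma>
    proof -
      have "{y \<in> space M. v y \<le> \<sigma>} \<in> sets M" by measurable
      then show ?thesis by (simp add: F_def space_UNIV)
    qed
    define J where "J \<sigma> = (\<integral>\<^sup>+y\<in>F \<sigma>. ennreal (f y) \<partial>M)" for \<sigma>
    define \<beta> where "\<beta> = 1 - (1 - lam) / s"
    have \<beta>: "0 \<le> \<beta>" "\<beta> \<le> 1"
      using s lam by (auto simp: \<beta>_def)
    \<comment> \<open>Both bounds come from one ball covering the sublevel set: the first from the
      averages, the second from the Morrey bound. If there is no such ball, the sublevel set is
      contained in the null set \<open>{x}\<close> and the integral vanishes.\<close>
    have J: "J \<sigma> \<le> ennreal (c * \<sigma> * u) \<and> J \<sigma> \<le> ennreal (2 * N * c * \<sigma> powr \<beta>)" if \<sigma>: "0 < \<sigma>" for \<sigma>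
    proof (cases "F \<sigma> \<subseteq> {x}")
      case True
      have "AE y in M. y \<notin> {x}"
        using point_null by (intro AE_not_in) (auto simp: null_sets_def)
      then have "AE y in M. ennreal (f y) * indicator (F \<sigma>) y = 0"
        by eventually_elim (use True in \<open>auto simp: indicator_def\<close>)
      then have "J \<sigma> = 0"
        unfolding J_def by (subst nn_integral_0_iff_AE) auto
      then show ?thesis by simp
    next
      case False
      then obtain r where r: "0 < r" "F \<sigma> \<subseteq> qball \<rho> x r" "measure M (qball \<rho> x r) \<le> c * \<sigma>"
        using sublevel[of x \<sigma>] unfolding F_def v_def by blast
      have J_le: "J \<sigma> \<le> (\<integral>\<^sup>+y\<in>qball \<rho> x r. ennreal (f y) \<partial>M)"
        unfolding J_def using r(2) by (intro nn_integral_mono) (auto simp: indicator_def)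
      also have "\<dots> \<le> ennreal (u * measure M (qball \<rho> x r))"
        using r(1) by (rule avg)
      also have "\<dots> \<le> ennreal (c * \<sigma> * u)"
        using r(3) u by (intro ennreal_leI) (simp add: mult.commute)
      finally have 1: "J \<sigma> \<le> ennreal (c * \<sigma> * u)" .
      note J_le
      also have "(\<integral>\<^sup>+y\<in>qball \<rho> x r. ennreal (f y) \<partial>M) \<le> ennreal (2 * N * measure M (qball \<rho> x r) powr \<beta>)"
        unfolding \<beta>_def using f0 mb N s r(1) by (intro morrey_bound_L1) auto
      also have "\<dots> \<le> ennreal (2 * N * c * \<sigma> powr \<beta>)"
      proof (rule ennreal_leI)
        have "measure M (qball \<rho> x r) powr \<beta> \<le> (c * \<sigma>) powr \<beta>"
          using r(3) \<beta> by (intro powr_mono2) auto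
        also have "\<dots> = c powr \<beta> * \<sigma> powr \<beta>"
          using c \<sigma> by (simp add: powr_mult)
        also have "\<dots> \<le> c * \<sigma> powr \<beta>"
          using c \<beta> powr_mono[of \<beta> 1 c] by (intro mult_right_mono) auto
        finally show "2 * N * measure M (qball \<rho> x r) powr \<beta> \<le> 2 * N * c * \<sigma> powr \<beta>"
          using N by simp
      qed
      finally show ?thesis using 1 by simp
    qed
    \<comment> \<open>The level that balances both series: it solves
      \<open>u * \<tau> powr \<alpha> = N * \<tau> powr - \<gamma>\<close>, because
      \<open>\<alpha> + \<gamma> = (1 - lam) / s\<close>.\<close>
    define \<tau> where "\<tau> = (N / u) powr (s / (1 - lam))"
    have \<tau>: "0 < \<tau>"
      using N u by (simp add: \<tau>_def)
    define a where "a j = (\<tau> / 2 ^ Suc j) powr (\<alpha> - 1)" for j :: nat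
    define b where "b j = (\<tau> * 2 ^ j) powr (\<alpha> - 1)" for j :: nat
    \<comment> \<open>Each dyadic shell is enlarged to a full sublevel set. The overcounting costs
      only a constant, and sublevel sets are what \<open>J\<close> controls.\<close>
    have pointwise: "ennreal (f y / v y powr (1 - \<alpha>)) \<le>
        (\<Sum>j. ennreal (a j) * (ennreal (f y) * indicator (F (\<tau> / 2 ^ j)) y)) +
        (\<Sum>j. ennreal (b j) * (ennreal (f y) * indicator (F (\<tau> * 2 ^ Suc j)) y))" for y
    proof (cases "y = x")
      case True
      \<comment> \<open>On the diagonal the ball is empty and division by zero makes the left side
        0.\<close>
      then have "v y = 0"
        by (simp add: v_def rho_eq_0_iff[THEN iffD2] measure_qball_nonpos)
      then show ?thesis by simp
    next
      case False
      then have "0 < \<rho> x y"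
        using rho_nonneg[of x y] rho_eq_0_iff[of x y] by auto
      then have v0: "0 < v y"
        unfolding v_def by (rule measure_qball_pos)
      have eq: "f y / v y powr (1 - \<alpha>) = v y powr (\<alpha> - 1) * f y"
        using powr_minus[of "v y" "1 - \<alpha>"] by (simp add: field_simps)
      show ?thesis
      proof (cases "v y \<le> \<tau>")
        case True
        then obtain n where n: "2 ^ n \<le> \<tau> / v y" "\<tau> / v y < 2 ^ Suc n"
          using ex_dyadic_scale[of "\<tau> / v y"] v0 by auto
        then have n': "v y \<le> \<tau> / 2 ^ n" "\<tau> / 2 ^ Suc n < v y"
          using v0 by (auto simp: field_simps)
        have "v y powr (\<alpha> - 1) \<le> a n"
          unfolding a_def using n' \<tau> \<alpha> by (intro powr_mono2') auto
        then have "ennreal (f y / v y powr (1 - \<alpha>)) \<le> ennreal (a n * f y)"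
          unfolding eq using f0 by (intro ennreal_leI mult_right_mono) auto
        also have "\<dots> = ennreal (a n) * (ennreal (f y) * indicator (F (\<tau> / 2 ^ n)) y)"
          using n' f0[of y] by (simp add: F_def ennreal_mult'')
        also have "\<dots> \<le> (\<Sum>j. ennreal (a j) * (ennreal (f y) * indicator (F (\<tau> / 2 ^ j)) y))"
          by (rule le_suminf_ennreal)
        finally show ?thesis by (rule order_trans) simp
      next
        case False
        then obtain n where n: "2 ^ n \<le> v y / \<tau>" "v y / \<tau> < 2 ^ Suc n"
          using ex_dyadic_scale[of "v y / \<tau>"] \<tau> by auto
        then have n': "\<tau> * 2 ^ n \<le> v y" "v y \<le> \<tau> * 2 ^ Suc n"
          using \<tau> by (auto simp: field_simps)
        have "v y powr (\<alpha> - 1) \<le> b n"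
          unfolding b_def using n' \<tau> \<alpha> by (intro powr_mono2') auto
        then have "ennreal (f y / v y powr (1 - \<alpha>)) \<le> ennreal (b n * f y)"
          unfolding eq using f0 by (intro ennreal_leI mult_right_mono) auto
        also have "\<dots> = ennreal (b n) * (ennreal (f y) * indicator (F (\<tau> * 2 ^ Suc n)) y)"
          using n' f0[of y] by (simp add: F_def ennreal_mult'')
        also have "\<dots> \<le> (\<Sum>j. ennreal (b j) * (ennreal (f y) * indicator (F (\<tau> * 2 ^ Suc j)) y))"
          by (rule le_suminf_ennreal)
        finally show ?thesis by (rule order_trans) simp
      qed
    qed
    define \<gamma> where "\<gamma> = (1 - lam) / t"
    have \<gamma>: "(1 - lam) / q \<le> \<gamma>" "0 < \<gamma>"
      using lam t q by (auto simp: \<gamma>_def intro: divide_left_mono)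
    \<comment> \<open>The kernel exponent \<open>\<alpha> - 1\<close> plus the Morrey growth
      \<open>\<beta>\<close> is negative, so the far series converges.\<close>
    have \<gamma>_eq: "\<alpha> - 1 + \<beta> = - \<gamma>"
    proof -
      have "(1 - lam) * (1 / s - 1 / t) = \<alpha>"
        using st lam by simp
      then show ?thesis by (simp add: \<beta>_def \<gamma>_def algebra_simps)
    qed
    define Z where "Z = N powr (1 - s / t) * u powr (s / t)"
    have Z: "0 < Z"
      using N u by (simp add: Z_def)
    have sA: "s / (1 - lam) * \<alpha> = 1 - s / t"
    proof -
      have "s / (1 - lam) * \<alpha> = s * (1 / s - 1 / t)"
        using st by simp
      also have "\<dots> = 1 - s / t"
        using s by (simp add: right_diff_distrib)
      finally show ?thesis .
    qed
    have near: "u * \<tau> powr \<alpha> = Z"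
    proof -
      have "\<tau> powr \<alpha> = (N / u) powr (1 - s / t)"
        by (simp only: \<tau>_def powr_powr sA)
      then have "u * \<tau> powr \<alpha> = N powr (1 - s / t) * (u powr 1 / u powr (1 - s / t))"
        using N u by (simp add: powr_divide)
      also have "u powr 1 / u powr (1 - s / t) = u powr (s / t)"
        by (simp only: powr_diff[symmetric]) simp
      finally show ?thesis by (simp add: Z_def)
    qed
    have far: "N * \<tau> powr - \<gamma> = Z"
    proof -
      have "s / (1 - lam) * - \<gamma> = - (s / t)"
        using lam by (simp add: \<gamma>_def)
      then have "\<tau> powr - \<gamma> = (N / u) powr - (s / t)"
        by (simp only: \<tau>_def powr_powr)
      also have "\<dots> = u powr (s / t) / N powr (s / t)"
        using N u by (simp add: powr_divide powr_minus)
      finally have "N * \<tau> powr - \<gamma> = (N powr 1 / N powr (s / t)) * u powr (s / t)"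
        using N by simp
      then show ?thesis
        by (simp only: powr_diff[symmetric] Z_def)
    qed
    have "(\<integral>\<^sup>+y. ennreal (f y / v y powr (1 - \<alpha>)) \<partial>M) \<le>
        (\<integral>\<^sup>+y. (\<Sum>j. ennreal (a j) * (ennreal (f y) * indicator (F (\<tau> / 2 ^ j)) y)) +
              (\<Sum>j. ennreal (b j) * (ennreal (f y) * indicator (F (\<tau> * 2 ^ Suc j)) y)) \<partial>M)"
      by (intro nn_integral_mono pointwise)
    also have "\<dots> = (\<Sum>j. ennreal (a j) * J (\<tau> / 2 ^ j)) + (\<Sum>j. ennreal (b j) * J (\<tau> * 2 ^ Suc j))"
      unfolding J_def by (simp add: nn_integral_add nn_integral_suminf nn_integral_cmult)
    also have "(\<Sum>j. ennreal (a j) * J (\<tau> / 2 ^ j)) \<le> ennreal (C1 * Z)"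
    proof -
      have "(\<Sum>j. ennreal (a j) * J (\<tau> / 2 ^ j)) \<le>
          (\<Sum>j. ennreal (2 powr (1 - \<alpha>) * c * Z * (2 powr - \<alpha>) ^ j))"
      proof (intro suminf_le allI)
        fix j
        have "ennreal (a j) * J (\<tau> / 2 ^ j) \<le> ennreal (a j) * ennreal (c * (\<tau> / 2 ^ j) * u)"
          using J[of "\<tau> / 2 ^ j"] \<tau> by (intro mult_left_mono) auto
        also have "\<dots> = ennreal (a j * (c * (\<tau> / 2 ^ j) * u))"
          by (rule ennreal_mult'[symmetric]) (simp add: a_def)
        also have "a j * (c * (\<tau> / 2 ^ j) * u) = 2 powr (1 - \<alpha>) * c * Z * (2 powr - \<alpha>) ^ j"
        proof -
          have "a j = ((\<tau> / 2 ^ j) / 2) powr (\<alpha> - 1)"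
            by (simp add: a_def mult.commute)
          also have "\<dots> = (\<tau> / 2 ^ j) powr (\<alpha> - 1) * 2 powr (1 - \<alpha>)"
            using \<tau> powr_minus_divide[of 2 "\<alpha> - 1"] by (subst powr_divide) auto
          finally have "a j * (c * (\<tau> / 2 ^ j) * u) =
              2 powr (1 - \<alpha>) * c * u * ((\<tau> / 2 ^ j) powr (\<alpha> - 1) * (\<tau> / 2 ^ j) powr 1)"
            using \<tau> by simp
          also have "(\<tau> / 2 ^ j) powr (\<alpha> - 1) * (\<tau> / 2 ^ j) powr 1 = (\<tau> / 2 ^ j) powr \<alpha>"
            by (simp only: powr_add[symmetric]) simp
          also have "\<dots> = \<tau> powr \<alpha> * (2 powr - \<alpha>) ^ j"
            using \<tau> by (simp add: powr_divide powr_minus powr_2_power[symmetric] field_simps)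
          finally show ?thesis
            by (simp add: near[symmetric] mult_ac)
        qed
        finally show "ennreal (a j) * J (\<tau> / 2 ^ j) \<le> ennreal (2 powr (1 - \<alpha>) * c * Z * (2 powr - \<alpha>) ^ j)" .
      qed auto
      also have "\<dots> = ennreal (2 powr (1 - \<alpha>) * c * Z / (1 - 2 powr - \<alpha>))"
        using c Z small by (intro suminf_ennreal_geometric) auto
      also have "\<dots> \<le> ennreal (C1 * Z)"
      proof (rule ennreal_leI)
        have "2 powr (1 - \<alpha>) * (c * Z / (1 - 2 powr - \<alpha>)) \<le> 2 * (c * Z / (1 - 2 powr - \<alpha>))"
          using c Z small \<alpha> powr_mono[of "1 - \<alpha>" 1 2] by (intro mult_right_mono) auto
        then show "2 powr (1 - \<alpha>) * c * Z / (1 - 2 powr - \<alpha>) \<le> C1 * Z"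
          by (simp add: C1_def mult.assoc)
      qed
      finally show ?thesis .
    qed
    also have "(\<Sum>j. ennreal (b j) * J (\<tau> * 2 ^ Suc j)) \<le> ennreal (C2 * Z)"
    proof -
      have "(\<Sum>j. ennreal (b j) * J (\<tau> * 2 ^ Suc j)) \<le>
          (\<Sum>j. ennreal (2 * 2 powr \<beta> * c * Z * (2 powr - \<gamma>) ^ j))"
      proof (intro suminf_le allI)
        fix j
        have "ennreal (b j) * J (\<tau> * 2 ^ Suc j) \<le> ennreal (b j) * ennreal (2 * N * c * (\<tau> * 2 ^ Suc j) powr \<beta>)"
          using J[of "\<tau> * 2 ^ Suc j"] \<tau> by (intro mult_left_mono) auto
        also have "\<dots> = ennreal (b j * (2 * N * c * (\<tau> * 2 ^ Suc j) powr \<beta>))"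
          by (rule ennreal_mult'[symmetric]) (simp add: b_def)
        also have "b j * (2 * N * c * (\<tau> * 2 ^ Suc j) powr \<beta>) = 2 * 2 powr \<beta> * c * Z * (2 powr - \<gamma>) ^ j"
        proof -
          have "(\<tau> * 2 ^ Suc j) powr \<beta> = (2 * (\<tau> * 2 ^ j)) powr \<beta>"
            by (simp add: mult_ac)
          also have "\<dots> = 2 powr \<beta> * (\<tau> * 2 ^ j) powr \<beta>"
            using \<tau> by (subst powr_mult) auto
          finally have "b j * (2 * N * c * (\<tau> * 2 ^ Suc j) powr \<beta>) =
              2 * 2 powr \<beta> * c * N * ((\<tau> * 2 ^ j) powr (\<alpha> - 1) * (\<tau> * 2 ^ j) powr \<beta>)"
            by (simp add: b_def)
          also have "(\<tau> * 2 ^ j) powr (\<alpha> - 1) * (\<tau> * 2 ^ j) powr \<beta> = (\<tau> * 2 ^ j) powr - \<gamma>"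
            by (simp only: powr_add[symmetric] \<gamma>_eq)
          also have "\<dots> = \<tau> powr - \<gamma> * (2 powr - \<gamma>) ^ j"
            using \<tau> by (simp add: powr_mult powr_2_power)
          finally show ?thesis
            by (simp add: far[symmetric] mult_ac)
        qed
        finally show "ennreal (b j) * J (\<tau> * 2 ^ Suc j) \<le> ennreal (2 * 2 powr \<beta> * c * Z * (2 powr - \<gamma>) ^ j)" .
      qed auto
      also have "\<dots> = ennreal (2 * 2 powr \<beta> * c * Z / (1 - 2 powr - \<gamma>))"
        using c Z \<gamma> by (intro suminf_ennreal_geometric) (auto simp: powr_less_one)
      also have "\<dots> \<le> ennreal (C2 * Z)"
      proof (rule ennreal_leI)
        have "2 powr \<beta> \<le> (2 :: real)"
          using powr_mono[of \<beta> 1 "2 :: real"] \<beta> by simp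
        moreover have "1 - 2 powr - ((1 - lam) / q) \<le> 1 - 2 powr - \<gamma>"
          using \<gamma> by simp
        ultimately have "2 * 2 powr \<beta> * c * Z / (1 - 2 powr - \<gamma>) \<le>
            4 * c * Z / (1 - 2 powr - ((1 - lam) / q))"
          using c Z small by (intro frac_le mult_right_mono) auto
        then show "2 * 2 powr \<beta> * c * Z / (1 - 2 powr - \<gamma>) \<le> C2 * Z"
          by (simp add: C2_def)
      qed
      finally show ?thesis .
    qed
    also have "ennreal (C1 * Z) + ennreal (C2 * Z) = ennreal ((C1 + C2) * Z)"
      using C1 C2 Z by (simp add: distrib_right)
    finally show ?thesis
      by (simp add: v_def Z_def add_mono)
  qed
  have K0: "1 \<le> C1 + C2"
    using C1 C2 by simp
  show ?thesis
    by (rule that[OF K0]) (rule main; (assumption | simp))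
qed

lemma potential_integrand_measurable [measurable]:
  assumes [measurable]: "f \<in> borel_measurable M"
  shows "potential_integrand M \<rho> \<alpha> f x \<in> borel_measurable M"
  unfolding potential_integrand_def by measurable

text \<open>Hedberg's bound raised to the power \<open>t\<close> is linear in \<open>\<Phi>\<close>,
  so a multiple of the maximal majorant dominates the potential and inherits its Morrey growth.
  Finiteness of \<open>H x\<close> also yields integrability, so that the potential there is a
  genuine integral.\<close>

lemma potential_majorant:
  fixes p q s0 \<alpha> lam :: real
  assumes s0: "1 < s0" and \<alpha>: "0 < \<alpha>" "\<alpha> < 1" and lam: "0 \<le> lam" "lam < 1" and q: "0 < q"
  obtains C where "1 \<le> C"
    and "\<And>f s t N x0 r0. f \<in> borel_measurable M \<Longrightarrow> s0 \<le> s \<Longrightarrow> s \<le> p \<Longrightarrow> 0 < t \<Longrightarrow> t \<le> q \<Longrightarrow>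
      1 / s - 1 / t = \<alpha> / (1 - lam) \<Longrightarrow> 0 < N \<Longrightarrow> morrey_bound s lam N (\<lambda>x. \<bar>f x\<bar>) \<Longrightarrow> 0 < r0 \<Longrightarrow>
      \<exists>H\<in>borel_measurable M.
        (\<forall>x\<in>qball \<rho> x0 r0. ennreal (\<bar>potential M \<rho> \<alpha> f x\<bar> powr t) \<le> H x \<and>
           (H x < \<infinity> \<longrightarrow> integrable M (potential_integrand M \<rho> \<alpha> f x))) \<and>
        (\<integral>\<^sup>+x\<in>qball \<rho> x0 r0. H x \<partial>M) \<le> ennreal ((C * N) powr t * measure M (qball \<rho> x0 r0) powr lam)"
proof -
  obtain K where K: "1 \<le> K" and max: "\<And>f s N x0 r0. f \<in> borel_measurable M \<Longrightarrow> (\<And>x. 0 \<le> f x) \<Longrightarrow>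
    s0 \<le> s \<Longrightarrow> s \<le> p \<Longrightarrow> 0 < N \<Longrightarrow> morrey_bound s lam N f \<Longrightarrow> 0 < r0 \<Longrightarrow>
    \<exists>\<Phi>\<in>borel_measurable M. (\<forall>x. 0 < \<Phi> x) \<and>
      (\<forall>x\<in>qball \<rho> x0 r0. \<forall>r u. 0 < r \<longrightarrow> 0 < u \<longrightarrow> \<Phi> x \<le> ennreal (u powr s) \<longrightarrow>
         (\<integral>\<^sup>+y\<in>qball \<rho> x r. ennreal (f y) \<partial>M) \<le> ennreal (u * measure M (qball \<rho> x r))) \<and>
      (\<integral>\<^sup>+x\<in>qball \<rho> x0 r0. \<Phi> x \<partial>M) \<le> ennreal (K * N powr s * measure M (qball \<rho> x0 r0) powr lam)"
    by (rule maximal_morrey[OF s0 lam, of p], rule that) (assumption, simp)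
  obtain Ch where Ch: "1 \<le> Ch" and hed: "\<And>f x s t N u. f \<in> borel_measurable M \<Longrightarrow> (\<And>y. 0 \<le> f y) \<Longrightarrow>
    1 \<le> s \<Longrightarrow> 0 < t \<Longrightarrow> t \<le> q \<Longrightarrow> 1 / s - 1 / t = \<alpha> / (1 - lam) \<Longrightarrow> 0 < N \<Longrightarrow> 0 < u \<Longrightarrow>
    morrey_bound s lam N f \<Longrightarrow>
    (\<And>r. 0 < r \<Longrightarrow> (\<integral>\<^sup>+y\<in>qball \<rho> x r. ennreal (f y) \<partial>M) \<le> ennreal (u * measure M (qball \<rho> x r))) \<Longrightarrow>
    (\<integral>\<^sup>+y. ennreal (f y / measure M (qball \<rho> x (\<rho> x y)) powr (1 - \<alpha>)) \<partial>M) \<le>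
      ennreal (Ch * (N powr (1 - s / t) * u powr (s / t)))"
    by (rule hedberg[OF \<alpha> lam q], rule that) (assumption, simp)
  have main: "\<exists>H\<in>borel_measurable M.
      (\<forall>x\<in>qball \<rho> x0 r0. ennreal (\<bar>potential M \<rho> \<alpha> f x\<bar> powr t) \<le> H x \<and>
         (H x < \<infinity> \<longrightarrow> integrable M (potential_integrand M \<rho> \<alpha> f x))) \<and>
      (\<integral>\<^sup>+x\<in>qball \<rho> x0 r0. H x \<partial>M) \<le> ennreal ((Ch * K * N) powr t * measure M (qball \<rho> x0 r0) powr lam)"
    if f[measurable]: "f \<in> borel_measurable M" and s: "s0 \<le> s" "s \<le> p" and t: "0 < t" "t \<le> q"
      and st: "1 / s - 1 / t = \<alpha> / (1 - lam)" and N: "0 < N"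
      and mb: "morrey_bound s lam N (\<lambda>x. \<bar>f x\<bar>)" and r0: "0 < r0" for f s t N x0 r0
  proof -
    have "0 < 1 / s - 1 / t"
      using st \<alpha> lam by simp
    then have st': "s < t"
      using s s0 t by (simp add: field_simps)
    obtain \<Phi> where \<Phi>[measurable]: "\<Phi> \<in> borel_measurable M" and \<Phi>0: "\<And>x. 0 < \<Phi> x"
      and avg: "\<And>x r u. x \<in> qball \<rho> x0 r0 \<Longrightarrow> 0 < r \<Longrightarrow> 0 < u \<Longrightarrow> \<Phi> x \<le> ennreal (u powr s) \<Longrightarrow>
         (\<integral>\<^sup>+y\<in>qball \<rho> x r. ennreal \<bar>f y\<bar> \<partial>M) \<le> ennreal (u * measure M (qball \<rho> x r))"
      and \<Phi>_int: "(\<integral>\<^sup>+x\<in>qball \<rho> x0 r0. \<Phi> x \<partial>M) \<le>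
        ennreal (K * N powr s * measure M (qball \<rho> x0 r0) powr lam)"
      using max[of "\<lambda>x. \<bar>f x\<bar>" s N r0 x0] s N mb r0 by auto
    \<comment> \<open>The coefficient of \<open>u powr s\<close> in the \<open>t\<close>-th power of
      Hedberg's bound, since \<open>(1 - s / t) * t = t - s\<close>.\<close>
    define c where "c = Ch powr t * N powr (t - s)"
    have c: "0 < c"
      using Ch N by (simp add: c_def)
    define H where "H x = ennreal c * \<Phi> x" for x
    have H[measurable]: "H \<in> borel_measurable M"
      unfolding H_def by measurable
    moreover have "ennreal (\<bar>potential M \<rho> \<alpha> f x\<bar> powr t) \<le> H x \<and>
         (H x < \<infinity> \<longrightarrow> integrable M (potential_integrand M \<rho> \<alpha> f x))"
      if x: "x \<in> qball \<rho> x0 r0" for x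
    proof (cases "\<Phi> x = \<infinity>")
      case True
      then show ?thesis
        using c by (simp add: H_def ennreal_mult_top)
    next
      case False
      then obtain \<phi> where \<phi>: "\<Phi> x = ennreal \<phi>" "0 < \<phi>"
        using \<Phi>0[of x] by (cases "\<Phi> x") (auto simp: ennreal_less_zero_iff)
      \<comment> \<open>The choice for which \<open>\<Phi> x \<le> u powr s\<close> holds with
        equality; positivity of \<open>\<Phi>\<close> gives \<open>0 < u\<close>.\<close>
      define u where "u = \<phi> powr (1 / s)"
      have u: "0 < u" "u powr s = \<phi>"
        using \<phi> s s0 by (auto simp: u_def powr_powr)
      define Y where "Y = Ch * (N powr (1 - s / t) * u powr (s / t))"
      have Y: "0 \<le> Y"
        using Ch by (simp add: Y_def)
      have "(\<integral>\<^sup>+y. ennreal (\<bar>f y\<bar> / measure M (qball \<rho> x (\<rho> x y)) powr (1 - \<alpha>)) \<partial>M) \<le> ennreal Y"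
        unfolding Y_def using s s0 t st N u mb avg[OF x] \<phi> by (intro hed) auto
      also have "(\<lambda>y. \<bar>f y\<bar> / measure M (qball \<rho> x (\<rho> x y)) powr (1 - \<alpha>)) =
          (\<lambda>y. norm (potential_integrand M \<rho> \<alpha> f x y))"
        by (simp add: potential_integrand_def fun_eq_iff)
      finally have *: "(\<integral>\<^sup>+y. ennreal (norm (potential_integrand M \<rho> \<alpha> f x y)) \<partial>M) \<le> ennreal Y" .
      then have int: "integrable M (potential_integrand M \<rho> \<alpha> f x)"
        by (intro integrableI_bounded) (auto intro: le_less_trans)
      have "ennreal \<bar>potential M \<rho> \<alpha> f x\<bar> \<le> ennreal Y"
        using integral_norm_bound_ennreal[OF int] * unfolding potential_def real_norm_def
        by (rule order_trans)
      then have "\<bar>potential M \<rho> \<alpha> f x\<bar> \<le> Y"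
        using Y by simp
      then have "\<bar>potential M \<rho> \<alpha> f x\<bar> powr t \<le> Y powr t"
        using t by (intro powr_mono2) auto
      also have "Y powr t = c * \<phi>"
      proof -
        have "Y powr t = Ch powr t * (N powr ((1 - s / t) * t) * u powr (s / t * t))"
          using Ch by (simp add: Y_def powr_mult powr_powr)
        also have "(1 - s / t) * t = t - s"
          using t by (simp add: left_diff_distrib)
        also have "s / t * t = s"
          using t by simp
        finally show ?thesis
          using u by (simp add: c_def)
      qed
      finally have "ennreal (\<bar>potential M \<rho> \<alpha> f x\<bar> powr t) \<le> H x"
        using c \<phi> by (simp add: H_def ennreal_mult''[symmetric] ennreal_leI)
      then show ?thesis using int by simp
    qed
    moreover have "(\<integral>\<^sup>+x\<in>qball \<rho> x0 r0. H x \<partial>M) \<le>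
        ennreal ((Ch * K * N) powr t * measure M (qball \<rho> x0 r0) powr lam)"
    proof -
      let ?V = "measure M (qball \<rho> x0 r0) powr lam"
      have "(\<integral>\<^sup>+x\<in>qball \<rho> x0 r0. H x \<partial>M) = ennreal c * (\<integral>\<^sup>+x\<in>qball \<rho> x0 r0. \<Phi> x \<partial>M)"
        unfolding H_def mult.assoc by (rule nn_integral_cmult) measurable
      also have "\<dots> \<le> ennreal c * ennreal (K * N powr s * ?V)"
        by (intro mult_left_mono \<Phi>_int) simp
      also have "\<dots> = ennreal (c * (K * N powr s * ?V))"
        using K by (simp add: ennreal_mult'')
      also have "\<dots> \<le> ennreal ((Ch * K * N) powr t * ?V)"
      proof (rule ennreal_leI)
        have "c * (K * N powr s * ?V) = Ch powr t * K * (N powr (t - s) * N powr s) * ?V"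
          by (simp add: c_def)
        also have "N powr (t - s) * N powr s = N powr t"
          by (simp add: powr_add[symmetric])
        \<comment> \<open>\<open>K \<le> K powr t\<close> because \<open>1 \<le> K\<close> and
          \<open>1 < t\<close>; this lets one constant go under the power \<open>t\<close>.\<close>
        also have "Ch powr t * K * N powr t * ?V \<le> Ch powr t * K powr t * N powr t * ?V"
          using K powr_mono[of 1 t K] s s0 st' by (intro mult_right_mono mult_left_mono) auto
        also have "\<dots> = (Ch * K * N) powr t * ?V"
          using Ch K N by (simp add: powr_mult)
        finally show "c * (K * N powr s * ?V) \<le> (Ch * K * N) powr t * ?V" .
      qed
      finally show ?thesis .
    qed
    ultimately show ?thesis by blast
  qed
  have K0: "1 \<le> Ch * K"
    using Ch K mult_mono[of 1 Ch 1 K] by simp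
  show ?thesis
    by (rule that[OF K0]) (rule main; (assumption | simp))
qed

section \<open>Measurability of the potential for jointly measurable \<open>\<rho>\<close>\<close>

text \<open>Completeness of \<open>M\<close>: sublevel sets that differ by a null set are measurable
  together.\<close>

lemma borel_measurable_AE_cong:
  fixes f g :: "'a \<Rightarrow> real"
  assumes [measurable]: "f \<in> borel_measurable M" and ae: "AE x in M. f x = g x"
  shows "g \<in> borel_measurable M"
  unfolding borel_measurable_iff_less
proof
  fix a
  show "{w \<in> space M. g w < a} \<in> sets M"
  proof (rule in_sets_AE)
    show "AE x in M. x \<in> {w \<in> space M. f w < a} \<longleftrightarrow> x \<in> {w \<in> space M. g w < a}"
      using ae by eventually_elim simp
  qed auto
qed

text \<open>\<open>F\<close> agrees almost everywhere with a product-measurable \<open>g\<close>,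
  hence on almost every section. Fubini's theorem applies to \<open>g\<close>, and completeness of
  \<open>M\<close> transfers the result to \<open>F\<close>.\<close>

lemma borel_measurable_integral_snd_completion:
  fixes F :: "'a \<Rightarrow> 'a \<Rightarrow> real"
  assumes F: "(\<lambda>z. F (fst z) (snd z)) \<in> borel_measurable (completion (M \<Otimes>\<^sub>M M))"
    and section_meas [measurable]: "\<And>x. F x \<in> borel_measurable M"
  shows "(\<lambda>x. \<integral>y. F x y \<partial>M) \<in> borel_measurable M"
proof -
  interpret MM: pair_sigma_finite M M ..
  obtain g where g[measurable]: "g \<in> borel_measurable (M \<Otimes>\<^sub>M M)"
    and eq: "AE z in M \<Otimes>\<^sub>M M. F (fst z) (snd z) = g z"
    using completion_ex_borel_measurable_real[OF F] by blast
  have "AE x in M. AE y in M. F x y = g (x, y)"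
    using MM.AE_pair[OF eq] by simp
  then have ae: "AE x in M. (\<integral>y. g (x, y) \<partial>M) = (\<integral>y. F x y \<partial>M)"
  proof eventually_elim
    case (elim x)
    have [measurable]: "(\<lambda>y. g (x, y)) \<in> borel_measurable M"
      by (rule measurable_Pair2[OF g]) (simp add: space_UNIV)
    show ?case
      using elim by (intro integral_cong_AE) auto
  qed
  have "(\<lambda>x. \<integral>y. g (x, y) \<partial>M) \<in> borel_measurable M"
    by (rule borel_measurable_lebesgue_integral) (simp add: g)
  then show ?thesis
    using ae by (rule borel_measurable_AE_cong)
qed

text \<open>For a fixed radius the measure of a ball is the section integral of an indicator, so it
  is measurable in the centre. Variable radii are limits of radii from a countable grid, by
  continuity in the radius; this makes the kernel jointly measurable.\<close>

lemma potential_borel_measurable: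
  assumes cont: "\<And>x. continuous_on {0<..} (\<lambda>t. measure M (qball \<rho> x t))"
    and \<rho>: "(\<lambda>(x, y). \<rho> x y) \<in> borel_measurable (completion (M \<Otimes>\<^sub>M M))"
    and f[measurable]: "f \<in> borel_measurable M"
  shows "potential M \<rho> \<alpha> f \<in> borel_measurable M"
proof -
  let ?P = "completion (M \<Otimes>\<^sub>M M)"
  have fst_P: "fst \<in> measurable ?P M" and snd_P: "snd \<in> measurable ?P M"
    by (auto intro: measurable_completion)
  have \<rho>_meas[measurable]: "(\<lambda>z. \<rho> (fst z) (snd z)) \<in> borel_measurable ?P"
    using \<rho> by (simp add: split_beta')
  have m_meas: "(\<lambda>x. measure M (qball \<rho> x r)) \<in> borel_measurable M" for r
  proof -
    have "(\<lambda>x. \<integral>y. (if \<rho> x y < r then 1 else 0 :: real) \<partial>M) \<in> borel_measurable M"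
      by (rule borel_measurable_integral_snd_completion) measurable
    moreover have "(\<lambda>y. if \<rho> x y < r then 1 else 0 :: real) = indicator (qball \<rho> x r)" for x
      by (auto simp: qball_def indicator_def)
    ultimately show ?thesis by (simp add: space_UNIV)
  qed
  \<comment> \<open>Rounding down to multiples of \<open>1 / Suc n\<close>, so that only countably
    many radii occur at each stage.\<close>
  define T where "T n t = of_int \<lfloor>real (Suc n) * t\<rfloor> / real (Suc n)" for n t
  have T_le: "T n t \<le> t" and T_ge: "t - 1 / real (Suc n) \<le> T n t" for n t
  proof -
    define k where "k = real (Suc n)"
    have k: "0 < k" by (simp add: k_def)
    have "T n t \<le> k * t / k"
      unfolding T_def k_def[symmetric] using k by (intro divide_right_mono) auto
    then show "T n t \<le> t" using k by simp
    have "(k * t - 1) / k \<le> T n t"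
      unfolding T_def k_def[symmetric] using k floor_correct[of "k * t"]
      by (intro divide_right_mono) auto
    then show "t - 1 / real (Suc n) \<le> T n t"
      using k by (simp add: k_def diff_divide_distrib)
  qed
  have T_lim: "(\<lambda>n. T n t) \<longlonglongrightarrow> t" for t
  proof (rule tendsto_sandwich)
    show "(\<lambda>n. t - 1 / real (Suc n)) \<longlonglongrightarrow> t"
      using tendsto_diff[OF tendsto_const[of t] LIMSEQ_inverse_real_of_nat]
      by (simp add: inverse_eq_divide)
  qed (use T_le T_ge in auto)
  have "(\<lambda>z. measure M (qball \<rho> (fst z) (\<rho> (fst z) (snd z)))) \<in> borel_measurable ?P"
  proof (rule borel_measurable_LIMSEQ_real)
    show "(\<lambda>z. measure M (qball \<rho> (fst z) (T n (\<rho> (fst z) (snd z))))) \<in> borel_measurable ?P" for n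
      unfolding T_def
    proof (rule measurable_compose_countable[where f = "\<lambda>i z. measure M (qball \<rho> (fst z) (of_int i / real (Suc n)))"])
      show "(\<lambda>z. measure M (qball \<rho> (fst z) (of_int i / real (Suc n)))) \<in> borel_measurable ?P" for i
        using measurable_compose[OF fst_P m_meas] .
    qed measurable
    fix z
    let ?t = "\<rho> (fst z) (snd z)"
    show "(\<lambda>n. measure M (qball \<rho> (fst z) (T n ?t))) \<longlonglongrightarrow> measure M (qball \<rho> (fst z) ?t)"
    proof (cases "0 < ?t")
      case True
      then have "isCont (\<lambda>t. measure M (qball \<rho> (fst z) t)) ?t"
        using cont[of "fst z"] by (simp add: continuous_on_eq_continuous_at)
      then show ?thesis
        using T_lim by (rule isCont_tendsto_compose)
    next
      \<comment> \<open>Continuity is available only at positive radii; on the diagonal the rounded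
        radius is 0 as well, so the sequence is constant.\<close>
      case False
      then have "?t = 0"
        using rho_nonneg[of "fst z" "snd z"] by simp
      then show ?thesis by (simp add: T_def)
    qed
  qed
  note [measurable] = this
  have [measurable]: "(\<lambda>z. f (snd z)) \<in> borel_measurable ?P"
    by (rule measurable_compose[OF snd_P f])
  show ?thesis
    unfolding potential_def
    by (rule borel_measurable_integral_snd_completion)
      (auto simp: potential_integrand_measurable, unfold potential_integrand_def, measurable)
qed

section \<open>Grand Morrey norms\<close>

text \<open>The strict ball may miss points at distance exactly the diameter. All larger balls are
  the whole space, so continuity of the measure at this radius makes the missed set null.\<close>

lemma AE_in_qball_qdiam:
  assumes "continuous_on {0<..} (\<lambda>t. measure M (qball \<rho> x t))"
  shows "AE y in M. y \<in> qball \<rho> x (qdiam \<rho>)"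
proof -
  have "isCont (\<lambda>t. measure M (qball \<rho> x t)) (qdiam \<rho>)"
    using assms qdiam_pos by (simp add: continuous_on_eq_continuous_at)
  moreover have "(\<lambda>n. qdiam \<rho> + inverse (real (Suc n))) \<longlonglongrightarrow> qdiam \<rho>"
    using tendsto_add[OF tendsto_const[of "qdiam \<rho>"] LIMSEQ_inverse_real_of_nat] by simp
  ultimately have "(\<lambda>n. measure M (qball \<rho> x (qdiam \<rho> + inverse (real (Suc n))))) \<longlonglongrightarrow>
      measure M (qball \<rho> x (qdiam \<rho>))"
    by (rule isCont_tendsto_compose)
  moreover have "qball \<rho> x (qdiam \<rho> + inverse (real (Suc n))) = UNIV" for n
    by (rule qball_eq_UNIV) simp
  ultimately have "measure M (qball \<rho> x (qdiam \<rho>)) = measure M UNIV"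
    by (simp add: LIMSEQ_const_iff)
  then have "measure M (space M - qball \<rho> x (qdiam \<rho>)) = 0"
    by (subst finite_measure_compl) (auto simp: space_UNIV)
  then have "AE y in M. y \<notin> space M - qball \<rho> x (qdiam \<rho>)"
    by (intro AE_not_in) (auto simp: null_sets_def emeasure_eq_measure)
  then show ?thesis
    by eventually_elim (simp add: space_UNIV)
qed

text \<open>The term \<open>\<epsilon> = p - s\<close> of the supremum gives the bound for radii
  below the diameter, and moving its weight to the other side produces
  \<open>(p - s) powr - (\<theta> / s)\<close>. Larger radii follow by exhaustion.\<close>

lemma grand_morrey_norm_imp_morrey_bound:
  assumes cont: "\<And>x. continuous_on {0<..} (\<lambda>t. measure M (qball \<rho> x t))"
    and f[measurable]: "f \<in> borel_measurable M" and lam: "0 \<le> lam"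
    and norm: "grand_morrey_norm M \<rho> p \<theta> lam f \<le> ennreal N" and N: "0 < N"
    and s: "1 < s" "s < p"
  shows "morrey_bound s lam (N * (p - s) powr - (\<theta> / s)) (\<lambda>x. \<bar>f x\<bar>)"
  unfolding morrey_bound_def
proof (intro allI impI)
  fix x and r :: real assume r: "0 < r"
  let ?N = "N * (p - s) powr - (\<theta> / s)"
  let ?I = "\<lambda>r. \<integral>\<^sup>+y\<in>qball \<rho> x r. ennreal (\<bar>f y\<bar> powr s) \<partial>M"
  have Ns: "?N powr s = N powr s * (p - s) powr - \<theta>"
    using N s by (simp add: powr_mult powr_powr)
  have small: "?I r \<le> ennreal (?N powr s * measure M (qball \<rho> x r) powr lam)"
    if r: "0 < r" "r < qdiam \<rho>" for r
  proof -
    define c where "c = (p - s) powr \<theta> / measure M (qball \<rho> x r) powr lam"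
    have c: "0 < c"
      using measure_qball_pos[OF r(1), of x] s by (simp add: c_def)
    have "powr_ennreal (ennreal c * ?I r) (1 / s) \<le> grand_morrey_norm M \<rho> p \<theta> lam f"
      unfolding grand_morrey_norm_def c_def
      by (rule SUP_upper2[of "p - s"], use s in simp, rule SUP_upper2[of x], simp,
          rule SUP_upper2[of r], use r in simp, simp)
    also note norm
    finally have "ennreal c * ?I r \<le> ennreal (N powr s)"
      using N s by (intro le_ennreal_of_powr_ennreal) auto
    then have "ennreal (1 / c) * (ennreal c * ?I r) \<le> ennreal (1 / c) * ennreal (N powr s)"
      by (rule mult_left_mono) simp
    then have "?I r \<le> ennreal (1 / c * N powr s)"
      using c by (simp add: mult.assoc[symmetric] ennreal_mult'[symmetric])
    also have "1 / c * N powr s = ?N powr s * measure M (qball \<rho> x r) powr lam"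
      unfolding Ns by (simp add: c_def powr_minus field_simps)
    finally show ?thesis .
  qed
  show "?I r \<le> ennreal (?N powr s * measure M (qball \<rho> x r) powr lam)"
  proof (cases "r < qdiam \<rho>")
    case False
    let ?d = "qdiam \<rho>" and ?\<nu> = "density M (\<lambda>y. ennreal (\<bar>f y\<bar> powr s))"
    \<comment> \<open>Radii in the open interval from 0 to the diameter that increase to the
      diameter: the norm tests only those, and their balls exhaust the space up to a null
      set.\<close>
    define R where "R n = ?d - ?d * inverse (real (Suc (Suc n)))" for n :: nat
    have R: "0 < R n" "R n < ?d" for n
      using qdiam_pos by (auto simp: R_def field_simps add_pos_nonneg)
    have mono_R: "R i \<le> R j" if "i \<le> j" for i j
      unfolding R_def using that qdiam_pos by (intro diff_mono mult_left_mono le_imp_inverse_le) auto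
    have lim_R: "R \<longlonglongrightarrow> ?d"
      unfolding R_def
      using tendsto_diff[OF tendsto_const[of ?d]
          tendsto_mult[OF tendsto_const[of ?d] LIMSEQ_Suc[OF LIMSEQ_inverse_real_of_nat]]]
      by simp
    have "?I r \<le> (\<integral>\<^sup>+y. ennreal (\<bar>f y\<bar> powr s) \<partial>M)"
      by (intro nn_integral_mono) (auto simp: indicator_def)
    also have "\<dots> = ?I ?d"
    proof (rule nn_integral_cong_AE)
      show "AE y in M. ennreal (\<bar>f y\<bar> powr s) = ennreal (\<bar>f y\<bar> powr s) * indicator (qball \<rho> x ?d) y"
        using AE_in_qball_qdiam[OF cont, of x] by eventually_elim simp
    qed
    also have "\<dots> = emeasure ?\<nu> (qball \<rho> x ?d)"
      by (simp add: emeasure_density)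
    also have "qball \<rho> x ?d = (\<Union>n. qball \<rho> x (R n))"
    proof -
      have "\<exists>n. \<rho> x y < R n" if "\<rho> x y < ?d" for y
        using order_tendstoD(1)[OF lim_R that] by (auto simp: eventually_sequentially)
      moreover have "\<rho> x y < ?d" if "\<rho> x y < R n" for y n
        using that R(2)[of n] by simp
      ultimately show ?thesis by (auto simp: qball_def)
    qed
    also have "emeasure ?\<nu> \<dots> = (SUP n. emeasure ?\<nu> (qball \<rho> x (R n)))"
      using mono_R by (intro SUP_emeasure_incseq[symmetric]) (auto intro!: monoI qball_mono)
    also have "\<dots> \<le> ennreal (?N powr s * measure M (qball \<rho> x r) powr lam)"
    proof (rule SUP_least)
      fix n
      have "emeasure ?\<nu> (qball \<rho> x (R n)) = ?I (R n)"
        by (simp add: emeasure_density)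
      also have "\<dots> \<le> ennreal (?N powr s * measure M (qball \<rho> x (R n)) powr lam)"
        using R by (intro small)
      also have "\<dots> \<le> ennreal (?N powr s * measure M (qball \<rho> x r) powr lam)"
        using lam R(2)[of n] False
        by (intro ennreal_leI mult_left_mono powr_mono2 measure_qball_mono) auto
      finally show "emeasure ?\<nu> (qball \<rho> x (R n)) \<le> \<dots>" .
    qed
    finally show ?thesis .
  qed (use r small in blast)
qed

end

section \<open>Assembly of the uniform estimates into the grand Morrey bound\<close>

text \<open>The norm inequality is meaningful for lower integrals, whereas membership in the target
  space includes measurability, hence the condition on \<open>\<rho>\<close> in the last conjunct.
  Almost everywhere integrability ensures that the potential is not the default value of a divergent
  integral.\<close>

theorem theorem5p1:
  fixes M :: "'a::topological_space measure"
    and \<rho> :: "'a \<Rightarrow> 'a \<Rightarrow> real"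
    and p q \<alpha> lam \<theta>1 \<theta>2 :: real
  assumes "homogeneous_type_space M \<rho>"
    and "\<And>x. continuous_on {0<..} (\<lambda>t. measure M (qball \<rho> x t))"
    and "1 < p"
    and "0 \<le> lam" and "lam < 1"
    and "0 < \<alpha>" and "\<alpha> < (1 - lam) / p"
    and "1 / p - 1 / q = \<alpha> / (1 - lam)"
    and "0 < \<theta>1"
    and "\<theta>2 = \<theta>1 * (1 + \<alpha> * q / (1 - lam))"
  shows "\<exists>C>0. \<forall>f \<in> grand_morrey M \<rho> p \<theta>1 lam.
    (AE x in M. integrable M (potential_integrand M \<rho> \<alpha> f x)) \<and>
    grand_morrey_norm M \<rho> q \<theta>2 lam (potential M \<rho> \<alpha> f)
      \<le> ennreal C * grand_morrey_norm M \<rho> p \<theta>1 lam f \<and>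
    ((\<lambda>(x, y). \<rho> x y) \<in> borel_measurable (completion (M \<Otimes>\<^sub>M M)) \<longrightarrow>
      potential M \<rho> \<alpha> f \<in> grand_morrey M \<rho> q \<theta>2 lam)"
proof -
  interpret homogeneous_type_space M \<rho> by fact
  note cont = assms(2) and p = assms(3) and lam = assms(4,5) and \<alpha>0 = assms(6)
    and \<alpha>p = assms(7) and pq = assms(8) and \<theta>1 = assms(9) and \<theta>2 = assms(10)
  define A where "A = \<alpha> / (1 - lam)"
  have A: "0 < A"
    using \<alpha>0 lam by (simp add: A_def)
  have "(1 - lam) / p \<le> 1"
    using p lam by (simp add: divide_le_eq)
  then have \<alpha>1: "\<alpha> < 1"
    using \<alpha>p by linarith
  have "A < 1 / p"
    using \<alpha>p lam p by (simp add: A_def field_simps)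
  moreover have "1 / q = 1 / p - A"
    using pq by (simp add: A_def)
  ultimately have "0 < 1 / q" by linarith
  then have q: "0 < q" by simp
  have "1 / q < 1 / p"
    using pq A by (simp add: A_def)
  then have qp: "p < q"
    using p q by (simp add: field_simps)
  have \<theta>2': "\<theta>2 = \<theta>1 * (1 + A * q)"
    by (simp add: \<theta>2 A_def)
  have pA: "1 / p - 1 / q = A"
    by (simp add: pq A_def)
  obtain Q where Q: "0 < Q" and exps: "\<And>\<epsilon>. 0 < \<epsilon> \<Longrightarrow> \<epsilon> < q - 1 \<Longrightarrow>
      \<exists>s t. (p + 1) / 2 \<le> s \<and> s < p \<and> 0 < t \<and> t \<le> q \<and> q - \<epsilon> \<le> t \<and> 1 / s - 1 / t = A \<and>
        \<epsilon> powr (\<theta>1 * (1 + A * q) / (q - \<epsilon>)) * (p - s) powr - (\<theta>1 / s) \<le> Q"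
    by (rule grand_exponents[OF p q A pA \<theta>1], rule that) (assumption, simp)
  have s0: "1 < (p + 1) / 2"
    using p by simp
  obtain C where C: "1 \<le> C" and maj: "\<And>f s t N x0 r0. f \<in> borel_measurable M \<Longrightarrow> (p + 1) / 2 \<le> s \<Longrightarrow>
      s \<le> p \<Longrightarrow> 0 < t \<Longrightarrow> t \<le> q \<Longrightarrow>
      1 / s - 1 / t = \<alpha> / (1 - lam) \<Longrightarrow> 0 < N \<Longrightarrow> morrey_bound s lam N (\<lambda>x. \<bar>f x\<bar>) \<Longrightarrow> 0 < r0 \<Longrightarrow>
      \<exists>H\<in>borel_measurable M.
        (\<forall>x\<in>qball \<rho> x0 r0. ennreal (\<bar>potential M \<rho> \<alpha> f x\<bar> powr t) \<le> H x \<and>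
           (H x < \<infinity> \<longrightarrow> integrable M (potential_integrand M \<rho> \<alpha> f x))) \<and>
        (\<integral>\<^sup>+x\<in>qball \<rho> x0 r0. H x \<partial>M) \<le> ennreal ((C * N) powr t * measure M (qball \<rho> x0 r0) powr lam)"
    by (rule potential_majorant[OF s0 \<alpha>0 \<alpha>1 lam q], rule that) (assumption, simp)
  \<comment> \<open>At least 1, so that powers of ball measures with exponent in
    \<open>[0, 1]\<close> are at most \<open>W\<close>.\<close>
  define W where "W = max 1 (measure M UNIV)"
  have W: "1 \<le> W" "measure M (qball \<rho> x r) \<le> W" for x r
    using measure_qball_le[of x r] by (auto simp: W_def)
  define C' where "C' = 2 * W * C * Q"
  have C': "0 < C'"
    using W C Q by (simp add: C'_def)
  \<comment> \<open>Stated for an arbitrary positive upper bound \<open>N\<close>, because the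
    Morrey estimates require a positive constant while the norm may be 0.\<close>
  have bound: "grand_morrey_norm M \<rho> q \<theta>2 lam (potential M \<rho> \<alpha> f) \<le> ennreal (C' * N)"
    if f[measurable]: "f \<in> borel_measurable M" and N: "0 < N"
      and norm: "grand_morrey_norm M \<rho> p \<theta>1 lam f \<le> ennreal N" for f N
    unfolding grand_morrey_norm_def
  proof (intro SUP_least)
    fix \<epsilon> x r assume "\<epsilon> \<in> {0<..<q - 1}" "r \<in> {0<..<qdiam \<rho>}"
    then have \<epsilon>: "0 < \<epsilon>" "\<epsilon> < q - 1" and r: "0 < r" by auto
    obtain s t where st: "(p + 1) / 2 \<le> s" "s < p" "0 < t" "t \<le> q" "q - \<epsilon> \<le> t" "1 / s - 1 / t = A"
      and Q_le: "\<epsilon> powr (\<theta>1 * (1 + A * q) / (q - \<epsilon>)) * (p - s) powr - (\<theta>1 / s) \<le> Q"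
      using exps[OF \<epsilon>] by blast
    define K where "K = C * (N * (p - s) powr - (\<theta>1 / s))"
    have K: "0 < K"
      using C N st by (simp add: K_def)
    define V where "V = measure M (qball \<rho> x r)"
    have V: "0 < V"
      unfolding V_def using r by (rule measure_qball_pos)
    define a where "a = q - \<epsilon>"
    have a: "1 < a" "a \<le> t"
      using \<epsilon> st by (auto simp: a_def)
    have "morrey_bound s lam (N * (p - s) powr - (\<theta>1 / s)) (\<lambda>x. \<bar>f x\<bar>)"
      using cont f lam norm N st p by (intro grand_morrey_norm_imp_morrey_bound) auto
    then obtain H where H[measurable]: "H \<in> borel_measurable M"
      and H_ge: "\<And>y. y \<in> qball \<rho> x r \<Longrightarrow> ennreal (\<bar>potential M \<rho> \<alpha> f y\<bar> powr t) \<le> H y"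
      and H_int: "(\<integral>\<^sup>+y\<in>qball \<rho> x r. H y \<partial>M) \<le> ennreal (K powr t * V powr lam)"
      using maj[of f s t "N * (p - s) powr - (\<theta>1 / s)" r x] st N r f unfolding K_def V_def A_def by auto
    \<comment> \<open>The majorant controls the exponent \<open>t\<close>; the Hoelder substitute
      lowers it to \<open>a = q - \<epsilon>\<close>.\<close>
    have "(\<integral>\<^sup>+y\<in>qball \<rho> x r. ennreal (\<bar>potential M \<rho> \<alpha> f y\<bar> powr a) \<partial>M) \<le>
        ennreal (2 * K powr a * V powr (1 - (1 - lam) * a / t))"
      unfolding V_def
      using r K a st H_ge H_int[unfolded V_def] by (intro morrey_holder[where H = H]) auto
    then have "ennreal (\<epsilon> powr \<theta>2 / V powr lam) * (\<integral>\<^sup>+y\<in>qball \<rho> x r. ennreal (\<bar>potential M \<rho> \<alpha> f y\<bar> powr a) \<partial>M) \<le>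
        ennreal (\<epsilon> powr \<theta>2 / V powr lam) * ennreal (2 * K powr a * V powr (1 - (1 - lam) * a / t))"
      by (rule mult_left_mono) simp
    also have "\<dots> = ennreal (\<epsilon> powr \<theta>2 / V powr lam * (2 * K powr a * V powr (1 - (1 - lam) * a / t)))"
      by (rule ennreal_mult'[symmetric]) simp
    also have "\<dots> \<le> ennreal (2 * W * \<epsilon> powr \<theta>2 * K powr a)"
    proof (rule ennreal_leI)
      \<comment> \<open>The power of \<open>V\<close> left over after lowering the exponent and
        dividing by \<open>V powr lam\<close>; it lies in \<open>[0, 1]\<close>.\<close>
      define e where "e = (1 - lam) * (1 - a / t)"
      have "0 \<le> a / t" "a / t \<le> 1"
        using a st by auto
      then have e: "0 \<le> e" "e \<le> 1"
        using lam mult_mono[of "1 - lam" 1 "1 - a / t" 1] by (auto simp: e_def)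
      have "V powr (1 - (1 - lam) * a / t) / V powr lam = V powr (1 - (1 - lam) * a / t - lam)"
        by (simp add: powr_diff)
      also have "1 - (1 - lam) * a / t - lam = e"
        by (simp add: e_def algebra_simps)
      also have "V powr e \<le> W powr e"
        using e V W(2)[of x r] by (intro powr_mono2) (auto simp: V_def)
      also have "W powr e \<le> W"
        using e W powr_mono[of e 1 W] by simp
      finally have "(2 * \<epsilon> powr \<theta>2 * K powr a) * (V powr (1 - (1 - lam) * a / t) / V powr lam) \<le>
          (2 * \<epsilon> powr \<theta>2 * K powr a) * W"
        by (rule mult_left_mono) simp
      then show "\<epsilon> powr \<theta>2 / V powr lam * (2 * K powr a * V powr (1 - (1 - lam) * a / t)) \<le>
          2 * W * \<epsilon> powr \<theta>2 * K powr a"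
        by (simp add: mult_ac)
    qed
    finally have "powr_ennreal (ennreal (\<epsilon> powr \<theta>2 / V powr lam) *
        (\<integral>\<^sup>+y\<in>qball \<rho> x r. ennreal (\<bar>potential M \<rho> \<alpha> f y\<bar> powr a) \<partial>M)) (1 / a) \<le>
        ennreal ((2 * W * \<epsilon> powr \<theta>2 * K powr a) powr (1 / a))"
      using W a by (intro powr_ennreal_le_ennreal) auto
    also have "\<dots> \<le> ennreal (C' * N)"
    proof (rule ennreal_leI)
      have "(2 * W * \<epsilon> powr \<theta>2 * K powr a) powr (1 / a) = (2 * W) powr (1 / a) * \<epsilon> powr (\<theta>2 / a) * K"
        using W(1) K a by (simp add: powr_mult powr_powr)
      also have "\<dots> \<le> (2 * W) * \<epsilon> powr (\<theta>2 / a) * K"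
      proof (intro mult_right_mono)
        show "(2 * W) powr (1 / a) \<le> 2 * W"
          using powr_mono[of "1 / a" 1 "2 * W"] W(1) a by simp
      qed (use K in auto)
      also have "\<dots> = 2 * W * C * N * (\<epsilon> powr (\<theta>2 / a) * (p - s) powr - (\<theta>1 / s))"
        by (simp add: K_def)
      also have "\<dots> \<le> 2 * W * C * N * Q"
        using Q_le W(1) C N by (intro mult_left_mono) (auto simp: \<theta>2' a_def)
      also have "\<dots> = C' * N"
        by (simp add: C'_def)
      finally show "(2 * W * \<epsilon> powr \<theta>2 * K powr a) powr (1 / a) \<le> C' * N" .
    qed
    finally show "powr_ennreal (ennreal (\<epsilon> powr \<theta>2 / measure M (qball \<rho> x r) powr lam) *
        (\<integral>\<^sup>+y\<in>qball \<rho> x r. ennreal (\<bar>potential M \<rho> \<alpha> f y\<bar> powr (q - \<epsilon>)) \<partial>M)) (1 / (q - \<epsilon>)) \<le>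
        ennreal (C' * N)"
      by (simp add: V_def a_def)
  qed
  have "(AE x in M. integrable M (potential_integrand M \<rho> \<alpha> f x)) \<and>
    grand_morrey_norm M \<rho> q \<theta>2 lam (potential M \<rho> \<alpha> f)
      \<le> ennreal C' * grand_morrey_norm M \<rho> p \<theta>1 lam f \<and>
    ((\<lambda>(x, y). \<rho> x y) \<in> borel_measurable (completion (M \<Otimes>\<^sub>M M)) \<longrightarrow>
      potential M \<rho> \<alpha> f \<in> grand_morrey M \<rho> q \<theta>2 lam)"
    if "f \<in> grand_morrey M \<rho> p \<theta>1 lam" for f
  proof -
    from that have f[measurable]: "f \<in> borel_measurable M"
      and "grand_morrey_norm M \<rho> p \<theta>1 lam f < \<infinity>"
      by (auto simp: grand_morrey_def)
    then obtain n where n: "grand_morrey_norm M \<rho> p \<theta>1 lam f = ennreal n" "0 \<le> n"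
      by (cases "grand_morrey_norm M \<rho> p \<theta>1 lam f") auto
    \<comment> \<open>The estimate is applied to \<open>n + e / C'\<close> for arbitrary
      \<open>e > 0\<close>, which includes the case \<open>n = 0\<close>.\<close>
    have norm_le: "grand_morrey_norm M \<rho> q \<theta>2 lam (potential M \<rho> \<alpha> f) \<le> ennreal (C' * n)"
    proof (rule ennreal_le_epsilon)
      fix e :: real assume e: "0 < e"
      have "grand_morrey_norm M \<rho> q \<theta>2 lam (potential M \<rho> \<alpha> f) \<le> ennreal (C' * (n + e / C'))"
        using n e C' by (intro bound f) (auto intro!: add_nonneg_pos ennreal_leI)
      also have "C' * (n + e / C') = C' * n + e"
        using C' by (simp add: distrib_left)
      also have "ennreal (C' * n + e) = ennreal (C' * n) + ennreal e"
        using C' n e by (simp add: ennreal_plus)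
      finally show "grand_morrey_norm M \<rho> q \<theta>2 lam (potential M \<rho> \<alpha> f) \<le> ennreal (C' * n) + ennreal e" .
    qed
    have "AE x in M. integrable M (potential_integrand M \<rho> \<alpha> f x)"
    proof -
      \<comment> \<open>One admissible pair of exponents is enough here. On a ball that is the whole
        space the majorant has finite integral, so it is finite almost everywhere.\<close>
      have "0 < (q - 1) / 2" "(q - 1) / 2 < q - 1"
        using p qp by auto
      from exps[OF this] obtain s t where st: "(p + 1) / 2 \<le> s" "s < p" "0 < t" "t \<le> q" "1 / s - 1 / t = A"
        by blast
      define N where "N = (n + 1) * (p - s) powr - (\<theta>1 / s)"
      have "morrey_bound s lam N (\<lambda>x. \<bar>f x\<bar>)"
        unfolding N_def using cont f lam n st p by (intro grand_morrey_norm_imp_morrey_bound) (auto intro: ennreal_leI)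
      moreover have "0 < N"
        using n st by (simp add: N_def)
      ultimately obtain H where H[measurable]: "H \<in> borel_measurable M"
        and int: "\<And>x. H x < \<infinity> \<Longrightarrow> integrable M (potential_integrand M \<rho> \<alpha> f x)"
        and H_int: "(\<integral>\<^sup>+x. H x \<partial>M) \<le> ennreal ((C * N) powr t * measure M UNIV powr lam)"
        using maj[of f s t N "qdiam \<rho> + 1" undefined] st f qdiam_pos
        by (auto simp: A_def qball_eq_UNIV)
      have "(\<integral>\<^sup>+x. H x \<partial>M) \<noteq> \<infinity>"
        using H_int by (auto simp: top_unique)
      then have "AE x in M. H x \<noteq> \<infinity>"
        by (intro nn_integral_noteq_infinite) auto
      then show ?thesis
        by eventually_elim (simp add: int less_top)
    qed
    moreover have "grand_morrey_norm M \<rho> q \<theta>2 lam (potential M \<rho> \<alpha> f) < \<infinity>"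
      using norm_le by (rule le_less_trans) simp
    ultimately show ?thesis
      using norm_le n C' potential_borel_measurable[OF cont _ f]
      by (simp add: grand_morrey_def ennreal_mult)
  qed
  then show ?thesis
    using C' by blast
qed

end
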